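(* In the two-group random mixture model, for a decision rule $\delta^n$ let $\mathrm{FN}(\delta^n)=\frac1n\sum_{i=1}^n\theta_i(1-\delta_i)$. Fix a level $\alpha\in[0,1]$. (i) For any $\beta\ge\mathsf{mEFN}^*(\alpha)$, the procedure $\delta^n_{\rm NP}(\alpha)$ satisfies, for any $\epsilon>0$, as $n\to\infty$, $$\mathbb P\big(\mathrm{FDP}(\delta^n_{\rm NP}(\alpha))\le\alpha+\epsilon\big)=1-o(1)\quad\text{and}\quad\mathbb P\big(\mathrm{FN}(\delta^n_{\rm NP}(\alpha))\le\beta+\epsilon\big)=1-o(1).$$ (ii) Conversely, if a sequence of decision rules $\delta^n$ satisfies $\mathbb P(\mathrm{FDP}(\delta^n)\le\alpha)=1-o(1)$ as $n\to\infty$ and $\mathrm{EFN}(\delta^n)\le\beta$, then $\beta\ge\mathsf{mEFN}^*(\alpha)$.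
   Context: Two-group random mixture model: $\pi_0,\pi_1\in(0,1)$ with $\pi_0+\pi_1=1$; $f_0,f_1$ are probability densities on a sample space $\mathcal X$ (with respect to a common dominating measure), $f=\pi_0f_0+\pi_1f_1$. The labels $\theta_1,\dots,\theta_n$ are iid $\mathrm{Bern}(\pi_1)$ and, conditionally on $\theta^n$, the observations $X_1,\dots,X_n$ are independent with $X_i\sim f_{\theta_i}$. A (possibly randomized) decision rule $\delta^n=(\delta_1,\dots,\delta_n)$ is given by a Markov kernel from $\mathcal X^n$ to $\{0,1\}^n$ applied to $X^n$ (so $\delta^n$ is conditionally independent of $\theta^n$ given $X^n$). Define $\mathrm{FDP}(\delta^n)=\frac{\sum_i\delta_i(1-\theta_i)}{1\vee\sum_i\delta_i}$, $\mathrm{mFDR}(\delta^n)=\frac{\mathbb E[\sum_i\delta_i(1-\theta_i)]}{\mathbb E[\sum_i\delta_i]}$ (with $0/0=0$), $\mathrm{EFN}(\delta^n)=\frac1n\mathbb E[\sum_{i=1}^n\theta_i(1-\delta_i)]$. $\mathsf{mEFN}^*(\alpha)=\inf\{\mathrm{EFN}(\delta^n):\mathrm{mFDR}(\delta^n)\le\alpha\}$, infimum over all decision rules; the value does not depend on $n$. Neyman-Pearson rule $\delta^n_{\rm NP}(\alpha)$: let $W_i=\pi_0f_0(X_i)/f(X_i)$, and let $W=\pi_0f_0(X)/f(X)$ with $X\sim f$, $G(t)=\mathbb P(W\le t)$, $G^{-1}(u)=\inf\{t\in[0,1]:G(t)\ge u\}$ for $u\in[0,1]$. For $u\in[0,1]$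 choose $p(u)\in[0,1]$ with $\mathbb P(W<G^{-1}(u))+p(u)\mathbb P(W=G^{-1}(u))=u$. Let $S_u=1$ if $W<G^{-1}(u)$, $S_u\sim\mathrm{Bern}(p(u))$ (independent coin) if $W=G^{-1}(u)$, $S_u=0$ if $W>G^{-1}(u)$. Set $a(u)=\mathbb E[W\mid S_u=1]$ for $u\in(0,1]$, $a(0)=0$, and $u^*(\alpha)=\sup\{u\in[0,1]:a(u)\le\alpha\}$. Then $\delta^n_{\rm NP}(\alpha)=(\delta_1,\dots,\delta_n)$ where $\delta_i=1$ if $W_i<G^{-1}(u^*(\alpha))$, $\delta_i\sim\mathrm{Bern}(p(u^*(\alpha)))$ (independent coins over $i$) if $W_i=G^{-1}(u^*(\alpha))$, and $\delta_i=0$ if $W_i>G^{-1}(u^*(\alpha))$. *)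

theory Defs
  imports "HOL-Probability.Probability"
begin

text \<open>
  The joint law of a pair \<open>(x, y)\<close> with \<open>x\<close> distributed according to \<open>A\<close> and, conditionally
  on \<open>x\<close>, \<open>y\<close> distributed according to the Markov kernel \<open>K x\<close> on \<open>B\<close>.
\<close>

definition kernel_joint :: "'a measure \<Rightarrow> 'b measure \<Rightarrow> ('a \<Rightarrow> 'b measure) \<Rightarrow> ('a \<times> 'b) measure"
  where "kernel_joint A B K = bind A (\<lambda>x. distr (K x) (A \<Otimes>\<^sub>M B) (Pair x))"


section \<open>The two-group model\<close>

definition prob_density :: "'a measure \<Rightarrow> ('a \<Rightarrow> real) \<Rightarrow> bool"
  where "prob_density M g \<longleftrightarrow>
    g \<in> borel_measurable M \<and> (\<forall>x\<in>space M. 0 \<le> g x) \<and> (\<integral>\<^sup>+ x. ennreal (g x) \<partial>M) = 1"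

text \<open>
  The law of \<open>(\<theta>, X)\<close>, with indices \<open>i < n\<close> in place of \<open>1, \<dots>, n\<close> and with the label \<open>True\<close>
  standing for 1. The labels outside the index range are set to the dummy value \<open>False\<close>.
\<close>

definition model_law ::
    "'a measure \<Rightarrow> ('a \<Rightarrow> real) \<Rightarrow> ('a \<Rightarrow> real) \<Rightarrow> real \<Rightarrow> nat \<Rightarrow> ((nat \<Rightarrow> bool) \<times> (nat \<Rightarrow> 'a)) measure"
  where "model_law M f0 f1 \<pi>1 n =
    kernel_joint
      (measure_pmf (Pi_pmf {..<n} False (\<lambda>_. bernoulli_pmf \<pi>1)))
      (\<Pi>\<^sub>M i\<in>{..<n}. M)
      (\<lambda>\<theta>. \<Pi>\<^sub>M i\<in>{..<n}. density M (\<lambda>x. ennreal (if \<theta> i then f1 x else f0 x)))"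

definition decision_space :: "nat \<Rightarrow> (nat \<Rightarrow> bool) measure"
  where "decision_space n = (\<Pi>\<^sub>M i\<in>{..<n}. count_space UNIV)"

text \<open>Decision rules are the Markov kernels from the observations to the decisions.\<close>

definition decision_rules :: "'a measure \<Rightarrow> nat \<Rightarrow> ((nat \<Rightarrow> 'a) \<Rightarrow> (nat \<Rightarrow> bool) measure) set"
  where "decision_rules M n = measurable (\<Pi>\<^sub>M i\<in>{..<n}. M) (prob_algebra (decision_space n))"

text \<open>
  The law of \<open>((\<theta>, X), d)\<close>; the kernel only sees \<open>X\<close>, so that \<open>d\<close> is conditionally independent
  of \<open>\<theta>\<close> given \<open>X\<close>.
\<close>

definition decision_law ::
    "'a measure \<Rightarrow> ('a \<Rightarrow> real) \<Rightarrow> ('a \<Rightarrow> real) \<Rightarrow> real \<Rightarrow> nat \<Rightarrow>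
     ((nat \<Rightarrow> 'a) \<Rightarrow> (nat \<Rightarrow> bool) measure) \<Rightarrow>
     (((nat \<Rightarrow> bool) \<times> (nat \<Rightarrow> 'a)) \<times> (nat \<Rightarrow> bool)) measure"
  where "decision_law M f0 f1 \<pi>1 n \<delta> =
    kernel_joint (model_law M f0 f1 \<pi>1 n) (decision_space n) (\<lambda>(\<theta>, X). \<delta> X)"


section \<open>Error criteria\<close>

definition rejections :: "nat \<Rightarrow> (nat \<Rightarrow> bool) \<Rightarrow> real"
  where "rejections n d = (\<Sum>i<n. of_bool (d i))"

definition false_rejections :: "nat \<Rightarrow> (nat \<Rightarrow> bool) \<Rightarrow> (nat \<Rightarrow> bool) \<Rightarrow> real"
  where "false_rejections n \<theta> d = (\<Sum>i<n. of_bool (d i) * (1 - of_bool (\<theta> i)))"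

definition FDP :: "nat \<Rightarrow> (nat \<Rightarrow> bool) \<Rightarrow> (nat \<Rightarrow> bool) \<Rightarrow> real"
  where "FDP n \<theta> d = false_rejections n \<theta> d / max 1 (rejections n d)"

definition FN :: "nat \<Rightarrow> (nat \<Rightarrow> bool) \<Rightarrow> (nat \<Rightarrow> bool) \<Rightarrow> real"
  where "FN n \<theta> d = 1 / real n * (\<Sum>i<n. of_bool (\<theta> i) * (1 - of_bool (d i)))"

text \<open>The convention \<open>0 / 0 = 0\<close> for mFDR is that of division in HOL.\<close>

definition mFDR ::
    "'a measure \<Rightarrow> ('a \<Rightarrow> real) \<Rightarrow> ('a \<Rightarrow> real) \<Rightarrow> real \<Rightarrow> nat \<Rightarrow>
     ((nat \<Rightarrow> 'a) \<Rightarrow> (nat \<Rightarrow> bool) measure) \<Rightarrow> real"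
  where "mFDR M f0 f1 \<pi>1 n \<delta> =
    (\<integral>((\<theta>, X), d). false_rejections n \<theta> d \<partial>decision_law M f0 f1 \<pi>1 n \<delta>) /
    (\<integral>((\<theta>, X), d). rejections n d \<partial>decision_law M f0 f1 \<pi>1 n \<delta>)"

definition EFN ::
    "'a measure \<Rightarrow> ('a \<Rightarrow> real) \<Rightarrow> ('a \<Rightarrow> real) \<Rightarrow> real \<Rightarrow> nat \<Rightarrow>
     ((nat \<Rightarrow> 'a) \<Rightarrow> (nat \<Rightarrow> bool) measure) \<Rightarrow> real"
  where "EFN M f0 f1 \<pi>1 n \<delta> = (\<integral>((\<theta>, X), d). FN n \<theta> d \<partial>decision_law M f0 f1 \<pi>1 n \<delta>)"

text \<open>
  The number \<open>n \<ge> 1\<close> of tests is an explicit argument, although the value does not depend on it.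
  The infimum is over a nonempty set bounded below by 0 if \<open>\<alpha> \<ge> 0\<close>, since never rejecting gives
  mFDR 0.
\<close>

definition mEFN_star ::
    "'a measure \<Rightarrow> ('a \<Rightarrow> real) \<Rightarrow> ('a \<Rightarrow> real) \<Rightarrow> real \<Rightarrow> nat \<Rightarrow> real \<Rightarrow> real"
  where "mEFN_star M f0 f1 \<pi>1 n \<alpha> =
    Inf {EFN M f0 f1 \<pi>1 n \<delta> | \<delta>. \<delta> \<in> decision_rules M n \<and> mFDR M f0 f1 \<pi>1 n \<delta> \<le> \<alpha>}"


section \<open>The Neyman-Pearson rule\<close>

definition mix_density :: "('a \<Rightarrow> real) \<Rightarrow> ('a \<Rightarrow> real) \<Rightarrow> real \<Rightarrow> real \<Rightarrow> 'a \<Rightarrow> real"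
  where "mix_density f0 f1 \<pi>0 \<pi>1 x = \<pi>0 * f0 x + \<pi>1 * f1 x"

text \<open>Where the mixture density vanishes, which is a null set, this has value 0.\<close>

definition W_stat :: "('a \<Rightarrow> real) \<Rightarrow> ('a \<Rightarrow> real) \<Rightarrow> real \<Rightarrow> real \<Rightarrow> 'a \<Rightarrow> real"
  where "W_stat f0 f1 \<pi>0 \<pi>1 x = \<pi>0 * f0 x / mix_density f0 f1 \<pi>0 \<pi>1 x"

text \<open>The law of the statistic under the mixture density; its distribution function \<open>G\<close> is
  \<open>cdf\<close> of this law.\<close>

definition W_law :: "'a measure \<Rightarrow> ('a \<Rightarrow> real) \<Rightarrow> ('a \<Rightarrow> real) \<Rightarrow> real \<Rightarrow> real \<Rightarrow> real measure"
  where "W_law M f0 f1 \<pi>0 \<pi>1 =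
    distr (density M (\<lambda>x. ennreal (mix_density f0 f1 \<pi>0 \<pi>1 x))) borel (W_stat f0 f1 \<pi>0 \<pi>1)"

text \<open>In the definitions below, \<open>\<mu>\<close> is the law of the statistic.\<close>

definition G_inv :: "real measure \<Rightarrow> real \<Rightarrow> real"
  where "G_inv \<mu> u = Inf {t \<in> {0..1}. cdf \<mu> t \<ge> u}"

definition randomization :: "real measure \<Rightarrow> (real \<Rightarrow> real) \<Rightarrow> bool"
  where "randomization \<mu> p \<longleftrightarrow>
    (\<forall>u\<in>{0..1}. p u \<in> {0..1} \<and>
      measure \<mu> {..<G_inv \<mu> u} + p u * measure \<mu> {G_inv \<mu> u} = u)"

definition np_test :: "real measure \<Rightarrow> (real \<Rightarrow> real) \<Rightarrow> real \<Rightarrow> real \<Rightarrow> bool pmf"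
  where "np_test \<mu> p u w =
    (if w < G_inv \<mu> u then return_pmf True
     else if w = G_inv \<mu> u then bernoulli_pmf (p u)
     else return_pmf False)"

text \<open>The joint law of \<open>(W, S\<^sub>u)\<close>; the library's \<open>uniform_measure\<close> conditions it on \<open>S\<^sub>u = 1\<close>.\<close>

definition WS_law :: "real measure \<Rightarrow> (real \<Rightarrow> real) \<Rightarrow> real \<Rightarrow> (real \<times> bool) measure"
  where "WS_law \<mu> p u =
    kernel_joint \<mu> (count_space UNIV) (\<lambda>w. measure_pmf (np_test \<mu> p u w))"

definition np_a :: "real measure \<Rightarrow> (real \<Rightarrow> real) \<Rightarrow> real \<Rightarrow> real"
  where "np_a \<mu> p u =
    (if u = 0 then 0
     else (\<integral>(w, s). w \<partial>uniform_measure (WS_law \<mu> p u) {(w, s). s}))"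

definition u_star :: "real measure \<Rightarrow> (real \<Rightarrow> real) \<Rightarrow> real \<Rightarrow> real"
  where "u_star \<mu> p \<alpha> = Sup {u \<in> {0..1}. np_a \<mu> p u \<le> \<alpha>}"

definition np_rule ::
    "'a measure \<Rightarrow> ('a \<Rightarrow> real) \<Rightarrow> ('a \<Rightarrow> real) \<Rightarrow> real \<Rightarrow> real \<Rightarrow> (real \<Rightarrow> real) \<Rightarrow> real \<Rightarrow> nat \<Rightarrow>
     (nat \<Rightarrow> 'a) \<Rightarrow> (nat \<Rightarrow> bool) measure"
  where "np_rule M f0 f1 \<pi>0 \<pi>1 p \<alpha> n X =
    (let \<mu> = W_law M f0 f1 \<pi>0 \<pi>1
     in \<Pi>\<^sub>M i\<in>{..<n}. measure_pmf (np_test \<mu> p (u_star \<mu> p \<alpha>) (W_stat f0 f1 \<pi>0 \<pi>1 (X i))))"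

end

theory Submission
  imports Defs
begin

text \<open>
  Given the observations, the labels are independent and \<open>\<theta>\<^sub>i\<close> is null with probability \<open>W\<^sub>i\<close>. Hence,
  for any rule, the expectation of \<open>\<theta>\<^sub>i (1 - d\<^sub>i) + L d\<^sub>i (1 - \<theta>\<^sub>i - \<alpha>)\<close> is at least that of the
  pointwise minimum of \<open>(1 - W) (1 - d) + L d (W - \<alpha>)\<close> over \<open>d\<close>. For a multiplier \<open>L \<ge> 0\<close> read off
  from the Neyman-Pearson test of size slightly above \<open>u\<^sup>*\<close>, the latter comes within any
  \<open>\<eta> > 0\<close> of the missed mass \<open>F\<close> of the test of size \<open>u\<^sup>*\<close>. Summing over \<open>i\<close> gives
  \<open>EFN + L E[V - \<alpha> R] / n \<ge> F - \<eta>\<close>, where \<open>V\<close> and \<open>R\<close> count the false and all rejections. This yields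
  \<open>mEFN\<^sup>* = F\<close>, and also the converse, because \<open>V - \<alpha> R \<le> n\<close> everywhere and
  \<open>V - \<alpha> R \<le> 0\<close> where \<open>FDP \<le> \<alpha>\<close>. Achievability is Chebyshev's inequality, the triples of label,
  observation and decision being independent and identically distributed under the
  Neyman-Pearson rule.
\<close>

section \<open>Kernels, finite products and second moments\<close>

context
  fixes A :: "'a measure" and B :: "'b measure" and K :: "'a \<Rightarrow> 'b measure"
  assumes K: "K \<in> A \<rightarrow>\<^sub>M prob_algebra B" and A: "prob_space A"
begin

lemma kernel_joint_kernel:
  "(\<lambda>x. distr (K x) (A \<Otimes>\<^sub>M B) (Pair x)) \<in> A \<rightarrow>\<^sub>M prob_algebra (A \<Otimes>\<^sub>M B)"
proof (rule measurable_prob_algebraI)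
  show "(\<lambda>x. distr (K x) (A \<Otimes>\<^sub>M B) (Pair x)) \<in> A \<rightarrow>\<^sub>M subprob_algebra (A \<Otimes>\<^sub>M B)"
    by (rule measurable_distr2[OF _ measurable_prob_algebraD[OF K]]) simp
  fix x assume x: "x \<in> space A"
  then have "K x \<in> space (prob_algebra B)" using K by (rule measurable_space[rotated])
  then have "prob_space (K x)" "sets (K x) = sets B" by (auto simp: space_prob_algebra)
  moreover have "Pair x \<in> K x \<rightarrow>\<^sub>M A \<Otimes>\<^sub>M B"
    using x \<open>sets (K x) = sets B\<close> by (simp cong: measurable_cong_sets)
  ultimately show "prob_space (distr (K x) (A \<Otimes>\<^sub>M B) (Pair x))"
    by (intro prob_space.prob_space_distr)
qed

lemma kernel_joint_sets_prob:
  shows sets_kernel_joint: "sets (kernel_joint A B K) = sets (A \<Otimes>\<^sub>M B)"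
    and prob_space_kernel_joint: "prob_space (kernel_joint A B K)"
proof -
  have "A \<in> space (prob_algebra A)" using A by (simp add: space_prob_algebra)
  from sets_bind'[OF this kernel_joint_kernel] prob_space_bind'[OF this kernel_joint_kernel]
  show "sets (kernel_joint A B K) = sets (A \<Otimes>\<^sub>M B)" "prob_space (kernel_joint A B K)"
    by (simp_all add: kernel_joint_def)
qed

text \<open>Fubini for a kernel. All integrals over \<open>WS_law\<close>, \<open>model_law\<close>
  and \<open>decision_law\<close> are reduced to iterated integrals by this identity.\<close>

lemma nn_integral_kernel_joint:
  assumes g: "g \<in> borel_measurable (A \<Otimes>\<^sub>M B)"
  shows "(\<integral>\<^sup>+z. g z \<partial>kernel_joint A B K) = (\<integral>\<^sup>+x. \<integral>\<^sup>+y. g (x, y) \<partial>K x \<partial>A)"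
proof -
  have "(\<integral>\<^sup>+z. g z \<partial>kernel_joint A B K)
      = (\<integral>\<^sup>+x. \<integral>\<^sup>+z. g z \<partial>distr (K x) (A \<Otimes>\<^sub>M B) (Pair x) \<partial>A)"
    unfolding kernel_joint_def
    by (rule nn_integral_bind[OF g measurable_prob_algebraD[OF kernel_joint_kernel]])
  also have "\<dots> = (\<integral>\<^sup>+x. \<integral>\<^sup>+y. g (x, y) \<partial>K x \<partial>A)"
  proof (rule nn_integral_cong)
    fix x assume x: "x \<in> space A"
    then have "sets (K x) = sets B"
      using measurable_space[OF K] by (auto simp: space_prob_algebra)
    then have "Pair x \<in> K x \<rightarrow>\<^sub>M A \<Otimes>\<^sub>M B"
      using x by (simp cong: measurable_cong_sets)
    then show "(\<integral>\<^sup>+z. g z \<partial>distr (K x) (A \<Otimes>\<^sub>M B) (Pair x)) = (\<integral>\<^sup>+y. g (x, y) \<partial>K x)"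
      using g by (simp add: nn_integral_distr)
  qed
  finally show ?thesis .
qed

end

text \<open>It suffices to test on the boxes that generate the product sigma-algebra, and the mass
  of a box is a finite product of measurable functions of \<open>x\<close>. This makes the
  Neyman-Pearson rule a Markov kernel.\<close>

lemma measurable_PiM_kernel:
  assumes "finite I"
    and prob: "\<And>i x. prob_space (K i x)"
    and K: "\<And>i. i \<in> I \<Longrightarrow> K i \<in> A \<rightarrow>\<^sub>M prob_algebra (B i)"
  shows "(\<lambda>x. \<Pi>\<^sub>M i\<in>I. K i x) \<in> A \<rightarrow>\<^sub>M prob_algebra (\<Pi>\<^sub>M i\<in>I. B i)"
proof (rule measurable_prob_algebra_generated[OF sets_PiM Int_stable_prod_algebra prod_algebra_sets_into_space])
  fix x assume x: "x \<in> space A"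
  show "prob_space (\<Pi>\<^sub>M i\<in>I. K i x)" by (intro prob_space_PiM prob)
  show "sets (\<Pi>\<^sub>M i\<in>I. K i x) = sets (\<Pi>\<^sub>M i\<in>I. B i)"
    using measurable_space[OF K x] by (intro sets_PiM_cong) (auto simp: space_prob_algebra)
next
  fix E assume "E \<in> prod_algebra I B"
  then obtain X where X: "E = (\<Pi>\<^sub>E i\<in>I. X i)" "\<And>i. i \<in> I \<Longrightarrow> X i \<in> sets (B i)"
    using \<open>finite I\<close> by (auto simp: prod_algebra_eq_finite)
  have "emeasure (\<Pi>\<^sub>M i\<in>I. K i x) E = (\<Prod>i\<in>I. emeasure (K i x) (X i))" if x: "x \<in> space A" for x
  proof -
    interpret product_prob_space "\<lambda>i. K i x"
      unfolding product_prob_space_def product_prob_space_axioms_def product_sigma_finite_def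
      using prob by (auto simp: prob_space_imp_sigma_finite)
    show ?thesis
      unfolding X(1) using measurable_space[OF K x] X(2) \<open>finite I\<close>
      by (intro emeasure_PiM) (auto simp: space_prob_algebra)
  qed
  moreover have "(\<lambda>x. \<Prod>i\<in>I. emeasure (K i x) (X i)) \<in> borel_measurable A"
  proof (rule borel_measurable_prod_ennreal)
    fix i assume "i \<in> I"
    then show "(\<lambda>x. emeasure (K i x) (X i)) \<in> borel_measurable A"
      using measurable_compose[OF measurable_prob_algebraD[OF K] measurable_emeasure_subprob_algebra] X(2)
      by auto
  qed
  ultimately show "(\<lambda>x. emeasure (\<Pi>\<^sub>M i\<in>I. K i x) E) \<in> borel_measurable A"
    by (simp cong: measurable_cong)
qed

text \<open>A measure on a finite product is determined by its values on boxes. There the indicator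
  of the box splits into a product, so that Fubini turns the integral of the product density into a
  product of integrals.\<close>

lemma PiM_density:
  fixes g :: "'i \<Rightarrow> 'a \<Rightarrow> ennreal"
  assumes "finite I" and N: "\<And>i. prob_space (N i)"
    and g[measurable]: "\<And>i. g i \<in> borel_measurable (N i)"
    and prob: "\<And>i. prob_space (density (N i) (g i))"
  shows "(\<Pi>\<^sub>M i\<in>I. density (N i) (g i)) = density (\<Pi>\<^sub>M i\<in>I. N i) (\<lambda>x. \<Prod>i\<in>I. g i (x i))"
proof -
  interpret N: product_sigma_finite N
    unfolding product_sigma_finite_def using N by (auto simp: prob_space_imp_sigma_finite)
  interpret D: product_sigma_finite "\<lambda>i. density (N i) (g i)"
    unfolding product_sigma_finite_def using prob by (auto simp: prob_space_imp_sigma_finite)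
  have "density (\<Pi>\<^sub>M i\<in>I. N i) (\<lambda>x. \<Prod>i\<in>I. g i (x i)) = (\<Pi>\<^sub>M i\<in>I. density (N i) (g i))"
  proof (rule D.PiM_eqI[OF \<open>finite I\<close>])
    show "sets (density (\<Pi>\<^sub>M i\<in>I. N i) (\<lambda>x. \<Prod>i\<in>I. g i (x i))) = sets (\<Pi>\<^sub>M i\<in>I. density (N i) (g i))"
      by (simp cong: sets_PiM_cong)
    fix A assume "\<And>i. i \<in> I \<Longrightarrow> A i \<in> sets (density (N i) (g i))"
    then have A[measurable]: "\<And>i. i \<in> I \<Longrightarrow> A i \<in> sets (N i)" by simp
    have "emeasure (density (\<Pi>\<^sub>M i\<in>I. N i) (\<lambda>x. \<Prod>i\<in>I. g i (x i))) (Pi\<^sub>E I A)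
        = (\<integral>\<^sup>+x. (\<Prod>i\<in>I. g i (x i)) * indicator (Pi\<^sub>E I A) x \<partial>(\<Pi>\<^sub>M i\<in>I. N i))"
      using A \<open>finite I\<close> by (intro emeasure_density) (auto intro!: sets_PiM_I_finite)
    also have "\<dots> = (\<integral>\<^sup>+x. (\<Prod>i\<in>I. g i (x i) * indicator (A i) (x i)) \<partial>(\<Pi>\<^sub>M i\<in>I. N i))"
    proof (rule nn_integral_cong)
      fix x assume x: "x \<in> space (\<Pi>\<^sub>M i\<in>I. N i)"
      then have "indicator (Pi\<^sub>E I A) x = (\<Prod>i\<in>I. indicator (A i) (x i) :: ennreal)"
        using \<open>finite I\<close> by (auto simp: indicator_def space_PiM PiE_iff prod_zero_iff)
      then show "(\<Prod>i\<in>I. g i (x i)) * indicator (Pi\<^sub>E I A) x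
          = (\<Prod>i\<in>I. g i (x i) * indicator (A i) (x i))"
        by (simp add: prod.distrib)
    qed
    also have "\<dots> = (\<Prod>i\<in>I. \<integral>\<^sup>+x. g i x * indicator (A i) x \<partial>N i)"
      by (rule N.product_nn_integral_prod[OF \<open>finite I\<close>]) simp
    also have "\<dots> = (\<Prod>i\<in>I. emeasure (density (N i) (g i)) (A i))"
      by (intro prod.cong refl) (simp add: emeasure_density)
    finally show "emeasure (density (\<Pi>\<^sub>M i\<in>I. N i) (\<lambda>x. \<Prod>i\<in>I. g i (x i))) (Pi\<^sub>E I A)
        = (\<Prod>i\<in>I. emeasure (density (N i) (g i)) (A i))" .
  qed
  then show ?thesis by simp
qed

text \<open>The coordinates outside \<open>J\<close> are given the factor 1, which integrates to 1
  under a probability measure; the full product formula then applies.\<close>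

lemma nn_integral_PiM_prod_subset:
  fixes f :: "'i \<Rightarrow> 'a \<Rightarrow> ennreal"
  assumes "finite I" "J \<subseteq> I" and N: "\<And>i. prob_space (N i)"
    and f: "\<And>i. i \<in> J \<Longrightarrow> f i \<in> borel_measurable (N i)"
  shows "(\<integral>\<^sup>+x. (\<Prod>j\<in>J. f j (x j)) \<partial>(\<Pi>\<^sub>M i\<in>I. N i)) = (\<Prod>j\<in>J. \<integral>\<^sup>+x. f j x \<partial>N j)"
proof -
  interpret product_sigma_finite N
    unfolding product_sigma_finite_def using N by (auto simp: prob_space_imp_sigma_finite)
  have J: "J = I \<inter> J" using \<open>J \<subseteq> I\<close> by auto
  have "(\<integral>\<^sup>+x. (\<Prod>j\<in>J. f j (x j)) \<partial>(\<Pi>\<^sub>M i\<in>I. N i))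
      = (\<integral>\<^sup>+x. (\<Prod>i\<in>I. (if i \<in> J then f i else (\<lambda>_. 1)) (x i)) \<partial>(\<Pi>\<^sub>M i\<in>I. N i))"
    using \<open>finite I\<close> by (subst J) (simp add: prod.inter_restrict if_distrib if_distribR)
  also have "\<dots> = (\<Prod>i\<in>I. integral\<^sup>N (N i) (if i \<in> J then f i else (\<lambda>_. 1)))"
    using \<open>finite I\<close> f by (intro product_nn_integral_prod) auto
  also have "\<dots> = (\<Prod>i\<in>I. if i \<in> J then integral\<^sup>N (N i) (f i) else 1)"
    using N by (intro prod.cong refl) (auto simp: prob_space.emeasure_space_1)
  also have "\<dots> = (\<Prod>j\<in>J. \<integral>\<^sup>+x. f j x \<partial>N j)"
    using \<open>finite I\<close> by (subst (2) J) (simp add: prod.inter_restrict)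
  finally show ?thesis .
qed

text \<open>A function of two bits is a nested conditional with four constant branches. The codomain
  is kept general because losses are needed both in \<open>ennreal\<close> and in
  \<open>real\<close>.\<close>

lemma measurable_bool_pair:
  fixes y :: "bool \<Rightarrow> bool \<Rightarrow> 'b :: topological_space"
  assumes [measurable]: "a \<in> K \<rightarrow>\<^sub>M count_space UNIV" "b \<in> K \<rightarrow>\<^sub>M count_space UNIV"
  shows "(\<lambda>z. y (a z) (b z)) \<in> borel_measurable K"
proof -
  have "y (a z) (b z) = (if a z then if b z then y True True else y True False
      else if b z then y False True else y False False)" for z by auto
  then show ?thesis by simp
qed

text \<open>Chebyshev's inequality for pairwise uncorrelated bounded variables with a common mean:
  the off-diagonal products cancel against the squared mean, and each diagonal term adds at most
  \<open>b\<^sup>2\<close> to the variance.\<close>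

lemma (in prob_space) sum_deviation_le:
  fixes Y :: "nat \<Rightarrow> 'a \<Rightarrow> real"
  assumes Y[measurable]: "\<And>i. i < n \<Longrightarrow> random_variable borel (Y i)"
    and bounds: "\<And>i x. i < n \<Longrightarrow> x \<in> space M \<Longrightarrow> 0 \<le> Y i x \<and> Y i x \<le> b"
    and mean: "\<And>i. i < n \<Longrightarrow> expectation (Y i) = c"
    and uncorr: "\<And>i j. i < n \<Longrightarrow> j < n \<Longrightarrow> i \<noteq> j \<Longrightarrow> expectation (\<lambda>x. Y i x * Y j x) = c * c"
    and "0 < t" "0 < n"
  shows "prob {x \<in> space M. real n * t \<le> \<bar>(\<Sum>i<n. Y i x) - real n * c\<bar>} \<le> b\<^sup>2 / (real n * t\<^sup>2)"
proof -
  have int: "integrable M (Y i)" if "i < n" for i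
    using that by (intro integrable_const_bound[where B = b]) (auto intro!: AE_I2 dest: bounds)
  have absle: "norm (Y i x * Y j x) \<le> b\<^sup>2" if "i < n" "j < n" "x \<in> space M" for i j x
    using bounds[of i x] bounds[of j x] that by (auto simp: power2_eq_square abs_mult intro!: mult_mono)
  have int2: "integrable M (\<lambda>x. Y i x * Y j x)" if "i < n" "j < n" for i j
    using that absle by (intro integrable_const_bound[where B = "b\<^sup>2"]) (auto intro!: AE_I2)
  have sq: "expectation (\<lambda>x. Y i x * Y i x) \<le> b\<^sup>2" if "i < n" for i
  proof -
    have "expectation (\<lambda>x. Y i x * Y i x) \<le> expectation (\<lambda>x. b\<^sup>2)"
      using int2[OF that that] absle[OF that that] by (intro integral_mono) auto
    then show ?thesis by (simp add: prob_space)
  qed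
  define S where "S x = (\<Sum>i<n. Y i x)" for x
  have S2: "(S x)\<^sup>2 = (\<Sum>i<n. \<Sum>j<n. Y i x * Y j x)" for x
    by (simp add: S_def power2_eq_square sum_product)
  have [measurable]: "random_variable borel S" unfolding S_def by measurable
  have intS2: "integrable M (\<lambda>x. (S x)\<^sup>2)" unfolding S2
    by (intro Bochner_Integration.integrable_sum int2) auto
  have ES: "expectation S = n * c" unfolding S_def using int mean
    by (subst Bochner_Integration.integral_sum) auto
  have intS: "integrable M S" unfolding S_def using int
    by (intro Bochner_Integration.integrable_sum) auto
  have "expectation (\<lambda>x. (S x)\<^sup>2) = (\<Sum>i<n. \<Sum>j<n. expectation (\<lambda>x. Y i x * Y j x))"
    unfolding S2 using int2
    by (subst Bochner_Integration.integral_sum, force)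
       (intro sum.cong refl Bochner_Integration.integral_sum, auto)
  \<comment> \<open>Adding the nonnegative \<open>c * c\<close> on the diagonal as well only
    enlarges the bound, and it makes the double sum collapse to
    \<open>n * b\<^sup>2 + (n * c)\<^sup>2\<close>.\<close>
  also have "\<dots> \<le> (\<Sum>i<n. \<Sum>j<n. (if i = j then b\<^sup>2 else 0) + c * c)"
    using sq uncorr by (intro sum_mono) (auto simp: add_increasing2)
  also have "\<dots> = n * b\<^sup>2 + (n * c)\<^sup>2"
    by (simp add: sum.distrib power2_eq_square algebra_simps)
  finally have "variance S \<le> n * b\<^sup>2"
    by (subst variance_eq) (auto simp: intS intS2 ES)
  moreover have "prob {x \<in> space M. \<bar>S x - expectation S\<bar> \<ge> real n * t} \<le> variance S / (real n * t)\<^sup>2"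
    using \<open>0 < t\<close> \<open>0 < n\<close> intS2 by (intro Chebyshev_inequality) auto
  ultimately have "prob {x \<in> space M. \<bar>S x - n * c\<bar> \<ge> real n * t} \<le> n * b\<^sup>2 / (real n * t)\<^sup>2"
    unfolding ES by (meson divide_right_mono order_trans zero_le_power2)
  also have "\<dots> = b\<^sup>2 / (real n * t\<^sup>2)"
    using \<open>0 < n\<close> by (simp add: power2_eq_square)
  finally show ?thesis by (simp add: S_def)
qed

section \<open>The Neyman-Pearson test for a given law of the statistic\<close>

lemma np_test_kernel: "(\<lambda>w. measure_pmf (np_test \<mu> p u w)) \<in> borel \<rightarrow>\<^sub>M prob_algebra (count_space UNIV)"
proof -
  have [measurable]: "(\<lambda>w. measure_pmf q) \<in> borel \<rightarrow>\<^sub>M prob_algebra (count_space UNIV)"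
    for q :: "bool pmf"
    by (rule measurable_const) (simp add: space_prob_algebra measure_pmf.prob_space_axioms)
  show ?thesis unfolding np_test_def if_distrib[of measure_pmf] by measurable
qed

text \<open>The one-dimensional problem, posed for an arbitrary law on the unit interval. The model
  enters the optimization only through the law of the posterior null probability \<open>W\<close>,
  which instantiates \<open>\<mu>\<close> later.\<close>

locale np_setting = real_distribution \<mu> for \<mu> :: "real measure" +
  fixes p :: "real \<Rightarrow> real" and \<alpha> :: real
  assumes range: "AE w in \<mu>. w \<in> {0..1}"
    and rand: "randomization \<mu> p"
    and level: "\<alpha> \<in> {0..1}"
begin

definition accept :: "real \<Rightarrow> real \<Rightarrow> real"
  where "accept u w = pmf (np_test \<mu> p u w) True"

text \<open>The expectation of \<open>W\<close> on the event of rejection, that is, the probability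
  of a false rejection by the test of size \<open>u\<close>. As a function of \<open>u\<close> it is
  convex, with \<open>G_inv \<mu> u\<close> as a subgradient; see \<open>I_diff_le\<close>.\<close>

definition I :: "real \<Rightarrow> real"
  where "I u = (\<integral>w. accept u w * w \<partial>\<mu>)"

lemma accept_eq:
  assumes "u \<in> {0..1}"
  shows "accept u w = (if w < G_inv \<mu> u then 1 else if w = G_inv \<mu> u then p u else 0)"
  using assms rand by (auto simp: accept_def np_test_def randomization_def)

lemma accept_nonneg: "0 \<le> accept u w"
  and accept_le_1: "accept u w \<le> 1"
  by (simp_all add: accept_def pmf_le_1)

lemma measurable_accept[measurable]: "accept u \<in> borel_measurable borel"
  unfolding accept_def np_test_def if_distrib[of "\<lambda>q. pmf q True"] by measurable

lemma integrable_unit: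
  assumes [measurable]: "g \<in> borel_measurable borel" and "\<And>w. w \<in> {0..1} \<Longrightarrow> \<bar>g w\<bar> \<le> b"
  shows "integrable \<mu> (g :: real \<Rightarrow> real)"
  using range assms by (intro integrable_const_bound[where B = b]) auto

lemma integrable_accept: "integrable \<mu> (accept u)"
  by (rule integrable_unit[where b = 1]) (auto simp: accept_nonneg accept_le_1)

lemma integrable_accept_times: "integrable \<mu> (\<lambda>w. accept u w * w)"
  by (rule integrable_unit[where b = 1])
    (auto simp: accept_nonneg accept_le_1 abs_mult intro!: mult_le_one)

lemma integrable_ident: "integrable \<mu> (\<lambda>w. w)"
  by (rule integrable_unit[where b = 1]) auto

lemmas integrable_basic = integrable_accept integrable_accept_times integrable_ident

lemma G_inv_in: "u \<in> {0..1} \<Longrightarrow> G_inv \<mu> u \<in> {0..1}"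
proof -
  assume u: "u \<in> {0..1}"
  have "prob {..1} = 1"
    using range by (subst prob_eq_1) auto
  then have 1: "1 \<in> {t \<in> {0..1}. cdf \<mu> t \<ge> u}" using u by (simp add: cdf_def)
  have "bdd_below {t \<in> {0..1}. cdf \<mu> t \<ge> u}" by (rule bdd_belowI[of _ 0]) auto
  with 1 have "G_inv \<mu> u \<le> 1" unfolding G_inv_def by (intro cInf_lower)
  moreover have "0 \<le> G_inv \<mu> u" unfolding G_inv_def using 1 by (intro cInf_greatest) auto
  ultimately show ?thesis by simp
qed

lemma integral_accept:
  assumes u: "u \<in> {0..1}"
  shows "(\<integral>w. accept u w \<partial>\<mu>) = u"
proof -
  have "accept u w = indicator {..<G_inv \<mu> u} w + p u * indicator {G_inv \<mu> u} w" for w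
    using u by (auto simp: accept_eq)
  moreover have "integrable \<mu> (indicator A :: real \<Rightarrow> real)" if "A \<in> sets borel" for A
    using that by (simp add: integrable_indicator_iff emeasure_eq_measure)
  ultimately have "(\<integral>w. accept u w \<partial>\<mu>) = measure \<mu> {..<G_inv \<mu> u} + p u * measure \<mu> {G_inv \<mu> u}"
    by simp
  then show ?thesis using u rand by (simp add: randomization_def)
qed

text \<open>The pointwise Neyman-Pearson argument: a linear function of \<open>h\<close> on the unit
  interval is minimal at \<open>h = 1\<close> where its slope is negative and at
  \<open>h = 0\<close> where it is positive. At the threshold the slope is 0, so the randomization
  does not affect the value.\<close>

lemma accept_optimal:
  assumes "u \<in> {0..1}" "0 \<le> h" "h \<le> 1"
  shows "accept u w * (w - G_inv \<mu> u) \<le> h * (w - G_inv \<mu> u)"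
proof (cases "w < G_inv \<mu> u")
  case True
  then show ?thesis using assms mult_right_mono_neg[of h 1 "w - G_inv \<mu> u"] by (simp add: accept_eq)
next
  case False
  then show ?thesis using assms by (auto simp: accept_eq)
qed

text \<open>Integrates \<open>accept_optimal\<close> with the test of size \<open>v\<close> as
  competitor; the sizes enter because \<open>accept\<close> has mean equal to its size. It yields
  the continuity of \<open>I\<close> needed at \<open>ustar\<close> and its monotonicity.\<close>

lemma I_diff_le:
  assumes u: "u \<in> {0..1}" and v: "v \<in> {0..1}"
  shows "I u - I v \<le> G_inv \<mu> u * (u - v)"
proof -
  have "(\<integral>w. accept u w * (w - G_inv \<mu> u) \<partial>\<mu>) \<le> (\<integral>w. accept v w * (w - G_inv \<mu> u) \<partial>\<mu>)"
    using accept_optimal[OF u accept_nonneg accept_le_1]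
    by (intro integral_mono) (auto simp: right_diff_distrib integrable_basic)
  moreover have "(\<integral>w. accept z w * (w - G_inv \<mu> u) \<partial>\<mu>) = I z - z * G_inv \<mu> u" if "z \<in> {0..1}" for z
    using integral_accept[OF that] by (simp add: right_diff_distrib integrable_basic I_def)
  ultimately have "I u - u * G_inv \<mu> u \<le> I v - v * G_inv \<mu> u" using u v by metis
  then show ?thesis by (simp add: algebra_simps)
qed

lemma I_le: "u \<in> {0..1} \<Longrightarrow> I u \<le> G_inv \<mu> u * u"
proof -
  assume u: "u \<in> {0..1}"
  have "(\<integral>w. accept u w * (w - G_inv \<mu> u) \<partial>\<mu>) \<le> (\<integral>w. 0 \<partial>\<mu>)"
    using accept_optimal[OF u, of 0]
    by (intro integral_mono) (auto simp: right_diff_distrib integrable_basic)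
  moreover have "(\<integral>w. accept u w * (w - G_inv \<mu> u) \<partial>\<mu>) = I u - u * G_inv \<mu> u"
    using integral_accept[OF u] by (simp add: right_diff_distrib integrable_basic I_def)
  ultimately show ?thesis by (simp add: mult.commute)
qed

text \<open>The event of rejection has probability \<open>u\<close> by the choice of the
  randomization, and the integral of \<open>W\<close> over it is \<open>I u\<close>. The condition
  \<open>np_a \<mu> p u \<le> \<alpha>\<close> thereby becomes the inequality
  \<open>I u \<le> \<alpha> * u\<close>.\<close>

lemma np_a_eq:
  assumes u: "u \<in> {0<..1}"
  shows "np_a \<mu> p u = I u / u"
proof -
  let ?C = "count_space (UNIV :: bool set)" and ?S = "{(w :: real, s). s}"
  have K: "(\<lambda>w. measure_pmf (np_test \<mu> p u w)) \<in> \<mu> \<rightarrow>\<^sub>M prob_algebra ?C"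
    using np_test_kernel by simp
  have borel: "sets (\<mu> \<Otimes>\<^sub>M ?C) = sets (borel \<Otimes>\<^sub>M ?C)"
    by (intro sets_pair_measure_cong) simp_all
  have sets[measurable_cong]: "sets (WS_law \<mu> p u) = sets (borel \<Otimes>\<^sub>M ?C)"
    unfolding WS_law_def sets_kernel_joint[OF K prob_space_axioms] by (rule borel)
  interpret WS: prob_space "WS_law \<mu> p u"
    unfolding WS_law_def by (rule prob_space_kernel_joint[OF K prob_space_axioms])
  have space: "space (WS_law \<mu> p u) = UNIV"
    using sets_eq_imp_space_eq[OF sets] by (simp add: space_pair_measure)
  have "Measurable.pred (borel \<Otimes>\<^sub>M ?C) (\<lambda>z. snd z)" by measurable
  then have "{z \<in> space (borel \<Otimes>\<^sub>M ?C). snd z} \<in> sets (borel \<Otimes>\<^sub>M ?C)"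
    by (rule measurable_sets_Collect) simp
  then have S[measurable]: "?S \<in> sets (WS_law \<mu> p u)"
    unfolding sets by (simp add: space_pair_measure case_prod_unfold)
  have [measurable]: "?S \<in> sets (borel \<Otimes>\<^sub>M ?C)" using S unfolding sets .
  \<comment> \<open>Integrating out the coin turns the restriction to rejection into the weight
    \<open>accept u w\<close>. The constant function 1 gives the normalization, the identity the
    numerator.\<close>
  have nn: "(\<integral>\<^sup>+z. g (fst z) * indicator ?S z \<partial>WS_law \<mu> p u) = (\<integral>\<^sup>+w. g w * ennreal (accept u w) \<partial>\<mu>)"
    if [measurable]: "g \<in> borel_measurable borel" for g
  proof -
    have "(\<integral>\<^sup>+z. g (fst z) * indicator ?S z \<partial>WS_law \<mu> p u)
        = (\<integral>\<^sup>+w. \<integral>\<^sup>+s. g w * indicator ?S (w, s) \<partial>measure_pmf (np_test \<mu> p u w) \<partial>\<mu>)"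
      unfolding WS_law_def by (subst nn_integral_kernel_joint[OF K prob_space_axioms]) simp_all
    also have "\<dots> = (\<integral>\<^sup>+w. g w * emeasure (np_test \<mu> p u w) {True} \<partial>\<mu>)"
    proof (rule nn_integral_cong)
      fix w
      have "(\<integral>\<^sup>+s. g w * indicator ?S (w, s) \<partial>measure_pmf (np_test \<mu> p u w))
          = (\<integral>\<^sup>+s. g w * indicator {True} s \<partial>measure_pmf (np_test \<mu> p u w))"
        by (intro nn_integral_cong) (auto simp: indicator_def)
      then show "(\<integral>\<^sup>+s. g w * indicator ?S (w, s) \<partial>measure_pmf (np_test \<mu> p u w))
          = g w * emeasure (np_test \<mu> p u w) {True}"
        by (simp add: nn_integral_cmult_indicator)
    qed
    finally show ?thesis by (simp add: emeasure_pmf_single accept_def)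
  qed
  have "emeasure (WS_law \<mu> p u) ?S = (\<integral>\<^sup>+w. ennreal (accept u w) \<partial>\<mu>)"
    using nn[of "\<lambda>_. 1"] by simp
  also have "\<dots> = ennreal u"
    using u integral_accept[of u]
    by (subst nn_integral_eq_integral) (auto simp: accept_nonneg integrable_basic)
  finally have ES: "emeasure (WS_law \<mu> p u) ?S = ennreal u" .
  \<comment> \<open>Nonnegativity of \<open>W\<close> has to be carried over to the joint law, so
    that the Bochner integral agrees with the nonnegative one.\<close>
  have range': "AE z in WS_law \<mu> p u. fst z \<in> {0..1}"
  proof (rule AE_I)
    let ?B = "{z :: real \<times> bool. fst z \<notin> {0..1}}"
    have "fst -` (- {0..1 :: real}) \<inter> space (borel \<Otimes>\<^sub>M ?C) \<in> sets (borel \<Otimes>\<^sub>M ?C)"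
      by (rule measurable_sets[OF measurable_fst]) auto
    moreover have "fst -` (- {0..1 :: real}) \<inter> space (borel \<Otimes>\<^sub>M ?C) = ?B"
      by (auto simp: space_pair_measure)
    ultimately have B: "?B \<in> sets (borel \<Otimes>\<^sub>M ?C)" by simp
    then show "?B \<in> sets (WS_law \<mu> p u)" unfolding sets .
    have "emeasure (WS_law \<mu> p u) ?B = (\<integral>\<^sup>+z. indicator ?B z \<partial>WS_law \<mu> p u)"
      using \<open>?B \<in> sets (WS_law \<mu> p u)\<close> by simp
    also have "\<dots> = (\<integral>\<^sup>+w. \<integral>\<^sup>+s. indicator ?B (w, s) \<partial>measure_pmf (np_test \<mu> p u w) \<partial>\<mu>)"
      unfolding WS_law_def using B
      by (subst nn_integral_kernel_joint[OF K prob_space_axioms]) (simp_all cong: measurable_cong_sets)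
    also have "\<dots> = (\<integral>\<^sup>+w. 0 \<partial>\<mu>)"
      using range by (intro nn_integral_cong_AE) (auto simp: indicator_def)
    finally show "emeasure (WS_law \<mu> p u) ?B = 0" by simp
  qed auto
  have "(\<integral>z. fst z \<partial>uniform_measure (WS_law \<mu> p u) ?S)
      = enn2real (\<integral>\<^sup>+z. ennreal (fst z) \<partial>uniform_measure (WS_law \<mu> p u) ?S)"
  proof (rule integral_eq_nn_integral)
    show "AE z in uniform_measure (WS_law \<mu> p u) ?S. 0 \<le> fst z"
      by (rule AE_uniform_measureI[OF S]) (use range' in auto)
  qed simp
  also have "\<dots> = enn2real ((\<integral>\<^sup>+w. ennreal w * ennreal (accept u w) \<partial>\<mu>) / ennreal u)"
    by (subst nn_integral_uniform_measure) (simp_all add: nn ES)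
  also have "(\<integral>\<^sup>+w. ennreal w * ennreal (accept u w) \<partial>\<mu>) = (\<integral>\<^sup>+w. ennreal (accept u w * w) \<partial>\<mu>)"
    using range by (intro nn_integral_cong_AE) (auto simp: ennreal_mult' accept_nonneg mult.commute)
  also have "\<dots> = ennreal (I u)"
    unfolding I_def using range
    by (intro nn_integral_eq_integral) (auto simp: accept_nonneg integrable_basic)
  also have "enn2real (ennreal (I u) / ennreal u) = I u / u"
  proof -
    have "0 \<le> I u" unfolding I_def using range
      by (intro integral_nonneg_AE) (auto simp: accept_nonneg)
    then show ?thesis using u by (simp add: divide_ennreal)
  qed
  finally show ?thesis using u by (simp add: np_a_def case_prod_unfold)
qed

section \<open>The critical size of the test\<close>

abbreviation "ustar \<equiv> u_star \<mu> p \<alpha>"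

text \<open>Sizes above the supremum violate the level by definition. That the supremum itself
  respects it uses that \<open>I\<close> grows with slope at most 1, by \<open>I_diff_le\<close> and
  \<open>G_inv_in\<close>, so the inequality passes from nearby admissible sizes to the
  limit.\<close>

lemma ustar_in: "ustar \<in> {0..1}"
  and I_ustar: "I ustar \<le> \<alpha> * ustar"
  and I_above: "u \<in> {ustar<..1} \<Longrightarrow> \<alpha> * u < I u"
proof -
  define A where "A = {u \<in> {0..1}. np_a \<mu> p u \<le> \<alpha>}"
  \<comment> \<open>Size 0 is admissible by the default value of \<open>np_a\<close>, whatever the
    level, so the supremum is over a nonempty set.\<close>
  have A: "u \<in> A \<longleftrightarrow> u = 0 \<or> (u \<in> {0<..1} \<and> I u \<le> \<alpha> * u)" for u
    using level np_a_eq[of u] by (auto simp: A_def divide_le_eq np_a_def[of _ _ 0] mult.commute)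
  have 0: "0 \<in> A" by (simp add: A)
  have bdd: "bdd_above A" by (rule bdd_aboveI[of _ 1]) (auto simp: A)
  have us: "ustar = Sup A" by (simp add: u_star_def A_def)
  show in01: "ustar \<in> {0..1}"
  proof -
    have "Sup A \<le> 1" using 0 by (intro cSup_least) (auto simp: A)
    then show ?thesis using cSup_upper[OF 0 bdd] by (simp add: us)
  qed
  have I0: "I 0 \<le> 0" using I_le[of 0] by simp
  show "u \<in> {ustar<..1} \<Longrightarrow> \<alpha> * u < I u"
    using cSup_upper[OF _ bdd, of u] in01 unfolding us by (force simp: A)
  show "I ustar \<le> \<alpha> * ustar"
  proof (rule field_le_epsilon)
    fix e :: real assume "0 < e"
    then obtain v where v: "v \<in> A" "ustar - e < v"
      unfolding us using 0 by (metis diff_less_eq empty_iff less_add_same_cancel1 less_cSup_iff bdd)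
    then have "v \<le> ustar" unfolding us by (intro cSup_upper bdd)
    have v01: "v \<in> {0..1}" and Iv: "I v \<le> \<alpha> * v" using v(1) I0 by (auto simp: A)
    have "I ustar - I v \<le> G_inv \<mu> ustar * (ustar - v)" by (rule I_diff_le[OF in01 v01])
    also have "\<dots> \<le> 1 * e" using G_inv_in[OF in01] v \<open>v \<le> ustar\<close> by (intro mult_mono) auto
    finally have "I ustar \<le> \<alpha> * v + e" using Iv by simp
    also have "\<dots> \<le> \<alpha> * ustar + e" using level \<open>v \<le> ustar\<close> by (auto intro: mult_left_mono)
    finally show "I ustar \<le> \<alpha> * ustar + e" .
  qed
qed

section \<open>The missed mass and its dual lower bound\<close>

definition miss :: "real \<Rightarrow> real"
  where "miss u = (\<integral>w. (1 - accept u w) * (1 - w) \<partial>\<mu>)"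

lemma miss_eq: "u \<in> {0..1} \<Longrightarrow> miss u = 1 - (\<integral>w. w \<partial>\<mu>) - u + I u"
proof -
  assume u: "u \<in> {0..1}"
  have "miss u = (\<integral>w. 1 - w - accept u w + accept u w * w \<partial>\<mu>)"
    unfolding miss_def by (intro Bochner_Integration.integral_cong) (auto simp: algebra_simps)
  then show ?thesis
    using integral_accept[OF u] prob_space by (simp add: I_def integrable_basic)
qed

text \<open>Lagrangian duality: the integrand is the minimum over the two decisions of the posterior
  expected loss \<open>\<theta> (1 - d) + L d (1 - \<theta> - \<alpha>)\<close>, shifted by \<open>L \<alpha>\<close> to be nonnegative. The supremum over
  the multiplier need not be attained (no Slater point exists if the statistic is at least \<open>\<alpha>\<close>
  almost surely), whence the \<open>\<eta>\<close>.\<close>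

lemma dual_certificate:
  assumes "0 < \<eta>"
  obtains L where "0 \<le> L"
    and "miss ustar - \<eta> + L * \<alpha> \<le> (\<integral>w. min (1 - w + L * \<alpha>) (L * w) \<partial>\<mu>)"
\<comment> \<open>The test of size 1 rejects almost surely and misses nothing, so the multiplier 0
  suffices. There is no larger size to read a multiplier from.\<close>
proof (cases "ustar = 1")
  case True
  have "miss ustar \<le> (\<integral>w. 1 - accept 1 w \<partial>\<mu>)"
    unfolding miss_def True using range
    by (intro integral_mono_AE integrable_unit[where b = 1])
      (auto simp: accept_nonneg accept_le_1 abs_mult intro!: mult_le_one mult_left_le)
  also have "\<dots> = 0"
    using integral_accept[of 1] prob_space by (simp add: integrable_basic)
  also have "0 \<le> (\<integral>w. min (1 - w) 0 \<partial>\<mu>)"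
    using range by (intro integral_nonneg_AE) auto
  finally show ?thesis using that[of 0] \<open>0 < \<eta>\<close> by simp
next
  case False
  \<comment> \<open>A size strictly above \<open>ustar\<close> violates the level strictly, which
    forces its threshold \<open>c\<close> to exceed \<open>\<alpha>\<close> and keeps the multiplier
    below finite. Staying within \<open>\<eta>\<close> of \<open>ustar\<close> bounds the change of
    \<open>miss\<close>.\<close>
  define u where "u = min 1 (ustar + \<eta>)"
  have u: "u \<in> {0..1}" "ustar < u" "u - ustar \<le> \<eta>"
    using ustar_in False \<open>0 < \<eta>\<close> by (auto simp: u_def)
  define c where "c = G_inv \<mu> u"
  have c: "c \<in> {0..1}" unfolding c_def by (rule G_inv_in[OF u(1)])
  have Iu: "\<alpha> * u < I u" using I_above u by simp
  have "0 < u" using u ustar_in by simp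
  have "\<alpha> * u < c * u" using Iu I_le[OF u(1)] by (simp add: c_def)
  then have "\<alpha> < c" using \<open>0 < u\<close> by (simp add: mult_less_cancel_right)
  \<comment> \<open>The multiplier is the one that makes the two posterior losses,
    \<open>1 - w + L * \<alpha>\<close> for acceptance and \<open>L * w\<close> for rejection, equal
    at the threshold \<open>w = c\<close>. The test of size \<open>u\<close> then attains their
    minimum at every \<open>w\<close>.\<close>
  define L where "L = (1 - c) / (c - \<alpha>)"
  have L: "L * (c - \<alpha>) = 1 - c" using \<open>\<alpha> < c\<close> by (simp add: L_def)
  have "0 \<le> L" using \<open>\<alpha> < c\<close> c by (simp add: L_def)
  have key: "L * w \<le> 1 - w + L * \<alpha> \<longleftrightarrow> w \<le> c" for w
  proof -
    have "1 - w + L * \<alpha> - L * w = (1 + L) * (c - w)" using L by (simp add: algebra_simps)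
    then have "L * w \<le> 1 - w + L * \<alpha> \<longleftrightarrow> 0 \<le> (1 + L) * (c - w)" by linarith
    also have "\<dots> \<longleftrightarrow> w \<le> c" using \<open>0 \<le> L\<close> by (simp add: zero_le_mult_iff)
    finally show ?thesis .
  qed
  have ptw: "(1 - accept u w) * (1 - w) + L * \<alpha> * (1 - accept u w) + L * (accept u w * w)
      = min (1 - w + L * \<alpha>) (L * w)" for w
  proof (cases "w = c")
    case True
    have "L * c = 1 - c + L * \<alpha>" using L by (simp add: algebra_simps)
    have "(1 - accept u c) * (1 - c) + L * \<alpha> * (1 - accept u c) + L * (accept u c * c)
        = (1 - accept u c) * (1 - c + L * \<alpha>) + accept u c * (L * c)"
      by (simp add: algebra_simps)
    also have "\<dots> = L * c" unfolding \<open>L * c = 1 - c + L * \<alpha>\<close> by (simp add: algebra_simps)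
    finally show ?thesis using \<open>L * c = 1 - c + L * \<alpha>\<close> by (simp add: True)
  next
    case False
    then show ?thesis using key[of w] by (auto simp: accept_eq[OF u(1)] c_def[symmetric] min_def)
  qed
  have "(\<integral>w. min (1 - w + L * \<alpha>) (L * w) \<partial>\<mu>)
      = (\<integral>w. (1 - accept u w) * (1 - w) + L * \<alpha> * (1 - accept u w) + L * (accept u w * w) \<partial>\<mu>)"
    using ptw by simp
  also have "\<dots> = miss u + L * \<alpha> * (1 - u) + L * I u"
  proof -
    have "integrable \<mu> (\<lambda>w. (1 - accept u w) * (1 - w))"
      by (rule integrable_unit[where b = 1])
        (auto simp: accept_nonneg accept_le_1 abs_mult intro!: mult_le_one)
    then show ?thesis
      using integral_accept[OF u(1)] prob_space by (simp add: integrable_basic miss_def I_def)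
  qed
  \<comment> \<open>The dropped term is \<open>L * (I u - \<alpha> * u)\<close>, nonnegative because
    \<open>u\<close> lies above \<open>ustar\<close>.\<close>
  also have "\<dots> \<ge> miss u + L * \<alpha>"
    using mult_left_mono[OF less_imp_le[OF Iu] \<open>0 \<le> L\<close>] by (simp add: algebra_simps)
  finally have 1: "miss u + L * \<alpha> \<le> (\<integral>w. min (1 - w + L * \<alpha>) (L * w) \<partial>\<mu>)" .
  have "I ustar - I u \<le> G_inv \<mu> ustar * (ustar - u)" by (rule I_diff_le[OF ustar_in u(1)])
  also have "\<dots> \<le> 0" using G_inv_in[OF ustar_in] u by (auto intro: mult_nonneg_nonpos)
  finally have "miss ustar - \<eta> \<le> miss u"
    using u by (simp add: miss_eq[OF ustar_in] miss_eq[OF u(1)])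
  with 1 \<open>0 \<le> L\<close> that show ?thesis by force
qed

end

section \<open>The two-group model through its posterior probabilities\<close>

locale two_group =
  fixes M :: "'a measure" and f0 f1 :: "'a \<Rightarrow> real" and \<pi>0 \<pi>1 :: real
  assumes \<pi>0: "\<pi>0 \<in> {0<..<1}" and \<pi>1: "\<pi>1 \<in> {0<..<1}" and \<pi>_sum: "\<pi>0 + \<pi>1 = 1"
    and f0: "prob_density M f0" and f1: "prob_density M f1"
begin

abbreviation "f \<equiv> mix_density f0 f1 \<pi>0 \<pi>1"
abbreviation "W \<equiv> W_stat f0 f1 \<pi>0 \<pi>1"
abbreviation "\<mu> \<equiv> W_law M f0 f1 \<pi>0 \<pi>1"
abbreviation "N \<equiv> density M (\<lambda>x. ennreal (f x))"
abbreviation "labels n \<equiv> Pi_pmf {..<n} False (\<lambda>_. bernoulli_pmf \<pi>1)"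
abbreviation "f_of t x \<equiv> (if t then f1 x else f0 x)"
abbreviation "D \<equiv> decision_law M f0 f1 \<pi>1"

lemma measurable_densities[measurable]:
  "f0 \<in> borel_measurable M" "f1 \<in> borel_measurable M"
  "f \<in> borel_measurable M" "W \<in> borel_measurable M"
proof -
  show [measurable]: "f0 \<in> borel_measurable M" "f1 \<in> borel_measurable M"
    using f0 f1 by (auto simp: prob_density_def)
  show [measurable]: "f \<in> borel_measurable M" unfolding mix_density_def[abs_def] by measurable
  show "W \<in> borel_measurable M" unfolding W_stat_def[abs_def] by measurable
qed

lemma density_nonneg: "x \<in> space M \<Longrightarrow> 0 \<le> f0 x" "x \<in> space M \<Longrightarrow> 0 \<le> f1 x"
  using f0 f1 by (auto simp: prob_density_def)

text \<open>Where the mixture density vanishes, both of its nonnegative summands vanish. The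
  identities therefore hold at every point, in spite of the default value of the quotient
  there.\<close>

lemma posterior:
  assumes "x \<in> space M"
  shows posterior_null: "f x * W x = \<pi>0 * f0 x"
    and posterior_alt: "f x * (1 - W x) = \<pi>1 * f1 x"
    and W_in: "W x \<in> {0..1}"
    and f_nonneg: "0 \<le> f x"
proof -
  have nn: "0 \<le> \<pi>0 * f0 x" "0 \<le> \<pi>1 * f1 x" using density_nonneg[OF assms] \<pi>0 \<pi>1 by auto
  then show "0 \<le> f x" by (simp add: mix_density_def)
  show *: "f x * W x = \<pi>0 * f0 x"
    using nn by (cases "f x = 0") (auto simp: W_stat_def mix_density_def add_nonneg_eq_0_iff)
  show "f x * (1 - W x) = \<pi>1 * f1 x"
    using * by (simp add: right_diff_distrib mix_density_def)
  show "W x \<in> {0..1}"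
    using nn by (auto simp: W_stat_def mix_density_def divide_le_eq_1)
qed

lemma prob_density_prob_space: "prob_density M g \<Longrightarrow> prob_space (density M (\<lambda>x. ennreal (g x)))"
  by (rule prob_spaceI) (auto simp: prob_density_def emeasure_density cong: nn_integral_cong)

lemma prob_space_group: "prob_space (density M (\<lambda>x. ennreal (f_of t x)))"
  using f0 f1 by (cases t) (simp_all add: prob_density_prob_space)

lemma prob_density_f: "prob_density M f"
proof -
  have "(\<integral>\<^sup>+x. ennreal (f x) \<partial>M) = (\<integral>\<^sup>+x. ennreal \<pi>0 * ennreal (f0 x) + ennreal \<pi>1 * ennreal (f1 x) \<partial>M)"
    using density_nonneg \<pi>0 \<pi>1
    by (intro nn_integral_cong) (auto simp: mix_density_def ennreal_mult' ennreal_plus)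
  also have "\<dots> = ennreal \<pi>0 + ennreal \<pi>1"
    using f0 f1 by (simp add: nn_integral_add nn_integral_cmult prob_density_def)
  also have "\<dots> = 1" using \<pi>0 \<pi>1 \<pi>_sum by (simp flip: ennreal_plus)
  finally show ?thesis using f_nonneg by (auto simp: prob_density_def)
qed

lemma prob_space_N: "prob_space N"
  by (rule prob_density_prob_space[OF prob_density_f])

text \<open>The density of an observation given its label, relative to the mixture law, in Bayes
  form: posterior over prior. Averaging over the label cancels the prior and leaves the
  posterior.\<close>

definition likelihood :: "bool \<Rightarrow> 'a \<Rightarrow> real"
  where "likelihood t x = (if t then (1 - W x) / \<pi>1 else W x / \<pi>0)"

lemma measurable_likelihood[measurable]: "likelihood t \<in> borel_measurable M"
  unfolding likelihood_def by measurable

lemma density_group: "density M (\<lambda>x. ennreal (f_of t x)) = density N (\<lambda>x. ennreal (likelihood t x))"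
proof -
  have "density N (\<lambda>x. ennreal (likelihood t x)) = density M (\<lambda>x. ennreal (f x) * ennreal (likelihood t x))"
    by (rule density_density_eq) auto
  also have "\<dots> = density M (\<lambda>x. ennreal (f_of t x))"
  proof (intro density_cong AE_I2)
    fix x assume x: "x \<in> space M"
    have "f x * likelihood t x = f_of t x"
      using posterior[OF x] \<pi>0 \<pi>1 by (auto simp: likelihood_def)
    then show "ennreal (f x) * ennreal (likelihood t x) = ennreal (f_of t x)"
      by (subst ennreal_mult'[symmetric]) (auto simp: f_nonneg[OF x])
  qed auto
  finally show ?thesis ..
qed

lemma model_kernel:
  fixes n :: nat
  shows "(\<lambda>\<theta>. \<Pi>\<^sub>M i\<in>{..<n}. density M (\<lambda>x. ennreal (f_of (\<theta> i) x)))
    \<in> measure_pmf (labels n) \<rightarrow>\<^sub>M prob_algebra (\<Pi>\<^sub>M i\<in>{..<n}. M)"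
proof (subst measurable_pmf_measure1, intro funcsetI)
  fix \<theta> :: "nat \<Rightarrow> bool"
  have "prob_space (\<Pi>\<^sub>M i\<in>{..<n}. density M (\<lambda>x. ennreal (f_of (\<theta> i) x)))"
    by (intro prob_space_PiM prob_space_group)
  moreover have "sets (\<Pi>\<^sub>M i\<in>{..<n}. density M (\<lambda>x. ennreal (f_of (\<theta> i) x))) = sets (\<Pi>\<^sub>M i\<in>{..<n}. M)"
    by (intro sets_PiM_cong) auto
  ultimately show "(\<Pi>\<^sub>M i\<in>{..<n}. density M (\<lambda>x. ennreal (f_of (\<theta> i) x)))
      \<in> space (prob_algebra (\<Pi>\<^sub>M i\<in>{..<n}. M))"
    by (simp add: space_prob_algebra)
qed

lemma sets_model_law: "sets (model_law M f0 f1 \<pi>1 n) = sets (measure_pmf (labels n) \<Otimes>\<^sub>M (\<Pi>\<^sub>M i\<in>{..<n}. M))"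
  unfolding model_law_def by (rule sets_kernel_joint[OF model_kernel measure_pmf.prob_space_axioms])

lemma prob_space_model_law: "prob_space (model_law M f0 f1 \<pi>1 n)"
  unfolding model_law_def by (rule prob_space_kernel_joint[OF model_kernel measure_pmf.prob_space_axioms])

section \<open>The joint law of labels, observations and decisions\<close>

context
  fixes n :: nat and \<delta> :: "(nat \<Rightarrow> 'a) \<Rightarrow> (nat \<Rightarrow> bool) measure"
  assumes \<delta>: "\<delta> \<in> decision_rules M n"
begin

lemma rule_kernel: "\<delta> \<in> (\<Pi>\<^sub>M i\<in>{..<n}. M) \<rightarrow>\<^sub>M prob_algebra (decision_space n)"
  using \<delta> by (simp add: decision_rules_def)

lemma decision_kernel: "(\<lambda>(\<theta>, X). \<delta> X) \<in> model_law M f0 f1 \<pi>1 n \<rightarrow>\<^sub>M prob_algebra (decision_space n)"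
  unfolding measurable_cong_sets[OF sets_model_law refl] case_prod_unfold
  by (rule measurable_compose[OF measurable_snd rule_kernel])

lemma sets_D[measurable_cong]:
  "sets (D n \<delta>) = sets ((measure_pmf (labels n) \<Otimes>\<^sub>M (\<Pi>\<^sub>M i\<in>{..<n}. M)) \<Otimes>\<^sub>M decision_space n)"
  unfolding decision_law_def sets_kernel_joint[OF decision_kernel prob_space_model_law]
  by (intro sets_pair_measure_cong sets_model_law refl)

lemma prob_space_D: "prob_space (D n \<delta>)"
  unfolding decision_law_def by (rule prob_space_kernel_joint[OF decision_kernel prob_space_model_law])

lemma nn_integral_D:
  assumes g[measurable]: "g \<in> borel_measurable ((measure_pmf (labels n) \<Otimes>\<^sub>M (\<Pi>\<^sub>M i\<in>{..<n}. M)) \<Otimes>\<^sub>M decision_space n)"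
  shows "(\<integral>\<^sup>+z. g z \<partial>D n \<delta>) = (\<integral>\<^sup>+\<theta>. \<integral>\<^sup>+X. \<integral>\<^sup>+d. g ((\<theta>, X), d) \<partial>\<delta> X
    \<partial>(\<Pi>\<^sub>M i\<in>{..<n}. density M (\<lambda>x. ennreal (f_of (\<theta> i) x))) \<partial>labels n)"
proof -
  let ?L = "measure_pmf (labels n) \<Otimes>\<^sub>M (\<Pi>\<^sub>M i\<in>{..<n}. M)"
  have "(\<integral>\<^sup>+z. g z \<partial>D n \<delta>) = (\<integral>\<^sup>+x. \<integral>\<^sup>+d. g (x, d) \<partial>(case x of (\<theta>, X) \<Rightarrow> \<delta> X) \<partial>model_law M f0 f1 \<pi>1 n)"
    unfolding decision_law_def
    using g by (intro nn_integral_kernel_joint[OF decision_kernel prob_space_model_law])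
      (simp cong: measurable_cong_sets sets_pair_measure_cong add: sets_model_law)
  also have "\<dots> = (\<integral>\<^sup>+\<theta>. \<integral>\<^sup>+X. \<integral>\<^sup>+d. g ((\<theta>, X), d) \<partial>(case (\<theta>, X) of (\<theta>, X) \<Rightarrow> \<delta> X)
      \<partial>(\<Pi>\<^sub>M i\<in>{..<n}. density M (\<lambda>x. ennreal (f_of (\<theta> i) x))) \<partial>labels n)"
    unfolding model_law_def
  proof (rule nn_integral_kernel_joint[OF model_kernel measure_pmf.prob_space_axioms])
    have "(\<lambda>(\<theta>, X). \<delta> X) \<in> ?L \<rightarrow>\<^sub>M subprob_algebra (decision_space n)"
      unfolding case_prod_unfold
      by (rule measurable_compose[OF measurable_snd measurable_prob_algebraD[OF rule_kernel]])
    then show "(\<lambda>x. \<integral>\<^sup>+d. g (x, d) \<partial>(case x of (\<theta>, X) \<Rightarrow> \<delta> X)) \<in> borel_measurable ?L"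
      by (intro nn_integral_measurable_subprob_algebra2[where N = "decision_space n"]) simp_all
  qed
  finally show ?thesis by simp
qed

lemma measurable_label: "(\<lambda>z. fst (fst z) j) \<in> D n \<delta> \<rightarrow>\<^sub>M count_space UNIV"
  unfolding measurable_cong_sets[OF sets_D refl]
  by (rule measurable_compose[OF measurable_compose[OF measurable_fst measurable_fst]]) simp

lemma measurable_decision: "j < n \<Longrightarrow> (\<lambda>z. snd z j) \<in> D n \<delta> \<rightarrow>\<^sub>M count_space UNIV"
  unfolding measurable_cong_sets[OF sets_D refl] decision_space_def
  by (rule measurable_compose[OF measurable_snd measurable_component_singleton]) simp

lemma measurable_loss:
  fixes y :: "bool \<Rightarrow> bool \<Rightarrow> 'c :: topological_space"
  shows "j < n \<Longrightarrow> (\<lambda>z. y (fst (fst z) j) (snd z j)) \<in> borel_measurable (D n \<delta>)"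
  by (intro measurable_bool_pair measurable_label measurable_decision)

text \<open>Integrates the labels out: given the observations they are independent, with null
  probability \<open>W (X j)\<close>, and the decision carries no further information on them.
  Products over \<open>J\<close> are treated so that a single coordinate gives means and two
  coordinates give correlations.\<close>

lemma nn_integral_D_posterior:
  fixes y :: "bool \<Rightarrow> bool \<Rightarrow> ennreal"
  assumes J: "J \<subseteq> {..<n}"
  shows "(\<integral>\<^sup>+z. (\<Prod>j\<in>J. y (fst (fst z) j) (snd z j)) \<partial>D n \<delta>)
    = (\<integral>\<^sup>+X. \<integral>\<^sup>+d. (\<Prod>j\<in>J. ennreal (W (X j)) * y False (d j) + ennreal (1 - W (X j)) * y True (d j))
        \<partial>\<delta> X \<partial>(\<Pi>\<^sub>M i\<in>{..<n}. N))"
proof -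
  let ?P = "\<Pi>\<^sub>M i\<in>{..<n}. N"
  let ?H = "\<lambda>\<theta> X. \<integral>\<^sup>+d. (\<Prod>j\<in>J. y (\<theta> j) (d j)) \<partial>\<delta> X"
  let ?g = "\<lambda>\<theta> X. \<Prod>i<n. ennreal (likelihood (\<theta> i) (X i))"
  have lt: "j < n" if "j \<in> J" for j using J that by auto
  have JI: "J = {..<n} \<inter> J" using J by auto
  have setsP: "sets ?P = sets (\<Pi>\<^sub>M i\<in>{..<n}. M)" by (intro sets_PiM_cong) auto
  have spaceP: "space ?P = space (\<Pi>\<^sub>M i\<in>{..<n}. M)" by (rule sets_eq_imp_space_eq[OF setsP])
  have comp: "(\<lambda>X. X i) \<in> ?P \<rightarrow>\<^sub>M M" if "i < n" for i
    unfolding measurable_cong_sets[OF setsP refl] using that by (intro measurable_component_singleton) simp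
  have [measurable]: "\<delta> \<in> ?P \<rightarrow>\<^sub>M subprob_algebra (decision_space n)"
    unfolding measurable_cong_sets[OF setsP refl] by (rule measurable_prob_algebraD[OF rule_kernel])
  have dec: "(\<lambda>d. q (d j)) \<in> borel_measurable (decision_space n)" if "j < n" for j and q :: "bool \<Rightarrow> ennreal"
    unfolding decision_space_def using that
    by (intro measurable_compose[OF measurable_component_singleton]) simp_all
  have prod_dec: "(\<lambda>d. \<Prod>j\<in>J. q j (d j)) \<in> borel_measurable (decision_space n)" for q :: "nat \<Rightarrow> bool \<Rightarrow> ennreal"
    by (intro borel_measurable_prod_ennreal dec lt)
  have H[measurable]: "?H \<theta> \<in> borel_measurable ?P" for \<theta>
    by (rule measurable_compose[OF _ nn_integral_measurable_subprob_algebra[OF prod_dec]]) measurable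
  have g[measurable]: "?g \<theta> \<in> borel_measurable ?P" for \<theta>
    by (intro borel_measurable_prod_ennreal measurable_compose[OF comp]) auto
  \<comment> \<open>The labels outside the index range are frozen, so only finitely many label
    vectors occur and the average over them commutes with the other integrals.\<close>
  have fin: "finite (set_pmf (labels n))"
    by (rule finite_subset[OF set_Pi_pmf_subset']) (auto intro!: finite_PiE_dflt)
  have "(\<integral>\<^sup>+z. (\<Prod>j\<in>J. y (fst (fst z) j) (snd z j)) \<partial>D n \<delta>)
      = (\<integral>\<^sup>+\<theta>. \<integral>\<^sup>+X. ?H \<theta> X \<partial>(\<Pi>\<^sub>M i\<in>{..<n}. density M (\<lambda>x. ennreal (f_of (\<theta> i) x))) \<partial>labels n)"
    using measurable_loss[OF lt, of _ y] unfolding measurable_cong_sets[OF sets_D refl]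
    by (subst nn_integral_D) (auto intro!: borel_measurable_prod_ennreal)
  \<comment> \<open>Change of measure: all label vectors now share one reference law, under which
    the observations are iid from the mixture.\<close>
  also have "\<dots> = (\<integral>\<^sup>+\<theta>. \<integral>\<^sup>+X. ?g \<theta> X * ?H \<theta> X \<partial>?P \<partial>labels n)"
  proof (rule nn_integral_cong)
    fix \<theta>
    have "(\<Pi>\<^sub>M i\<in>{..<n}. density M (\<lambda>x. ennreal (f_of (\<theta> i) x))) = density ?P (?g \<theta>)"
      unfolding density_group
      by (rule PiM_density)
        (auto simp: prob_space_N simp flip: density_group intro: prob_space_group)
    then show "(\<integral>\<^sup>+X. ?H \<theta> X \<partial>(\<Pi>\<^sub>M i\<in>{..<n}. density M (\<lambda>x. ennreal (f_of (\<theta> i) x))))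
        = (\<integral>\<^sup>+X. ?g \<theta> X * ?H \<theta> X \<partial>?P)"
      by (simp add: nn_integral_density)
  qed
  also have "\<dots> = (\<integral>\<^sup>+X. (\<Sum>\<theta>\<in>set_pmf (labels n). ?g \<theta> X * ?H \<theta> X * pmf (labels n) \<theta>) \<partial>?P)"
    by (subst nn_integral_measure_pmf_finite[OF fin])
      (simp_all add: nn_integral_sum nn_integral_multc)
  also have "\<dots> = (\<integral>\<^sup>+X. \<integral>\<^sup>+d. (\<Prod>j\<in>J. ennreal (W (X j)) * y False (d j) + ennreal (1 - W (X j)) * y True (d j))
        \<partial>\<delta> X \<partial>?P)"
  proof (rule nn_integral_cong)
    fix X assume X: "X \<in> space ?P"
    have sets\<delta>: "sets (\<delta> X) = sets (decision_space n)"
      using measurable_space[OF rule_kernel] X unfolding spaceP by (auto simp: space_prob_algebra)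
    have [measurable]: "(\<lambda>d. \<Prod>j\<in>J. y (\<theta> j) (d j)) \<in> borel_measurable (\<delta> X)" for \<theta>
      using prod_dec[of "\<lambda>j. y (\<theta> j)"] unfolding measurable_cong_sets[OF sets\<delta> refl] .
    have "(\<Sum>\<theta>\<in>set_pmf (labels n). ?g \<theta> X * ?H \<theta> X * pmf (labels n) \<theta>)
        = (\<integral>\<^sup>+d. (\<Sum>\<theta>\<in>set_pmf (labels n). (?g \<theta> X * (\<Prod>j\<in>J. y (\<theta> j) (d j))) * pmf (labels n) \<theta>) \<partial>\<delta> X)"
      by (simp add: nn_integral_sum nn_integral_multc nn_integral_cmult)
    also have "\<dots> = (\<integral>\<^sup>+d. \<integral>\<^sup>+\<theta>. ?g \<theta> X * (\<Prod>j\<in>J. y (\<theta> j) (d j)) \<partial>labels n \<partial>\<delta> X)"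
      by (simp add: nn_integral_measure_pmf_finite[OF fin])
    also have "\<dots> = (\<integral>\<^sup>+d. (\<Prod>j\<in>J. ennreal (W (X j)) * y False (d j) + ennreal (1 - W (X j)) * y True (d j)) \<partial>\<delta> X)"
    proof (rule nn_integral_cong)
      fix d
      have XM: "X i \<in> space M" if "i < n" for i
        using X that by (auto simp: space_PiM PiE_iff)
      have one: "(\<integral>\<^sup>+t. ennreal (likelihood t (X i)) * q t \<partial>bernoulli_pmf \<pi>1)
          = ennreal (W (X i)) * q False + ennreal (1 - W (X i)) * q True" if "i < n" for i q
      proof -
        have "1 - \<pi>1 = \<pi>0" using \<pi>_sum by simp
        have lik: "ennreal (likelihood False (X i)) * ennreal (1 - \<pi>1) = ennreal (W (X i))"
          "ennreal (likelihood True (X i)) * ennreal \<pi>1 = ennreal (1 - W (X i))"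
          using \<pi>0 \<pi>1 \<open>1 - \<pi>1 = \<pi>0\<close> W_in[OF XM[OF that]]
          by (auto simp: likelihood_def simp flip: ennreal_mult'')
        have "(\<integral>\<^sup>+t. ennreal (likelihood t (X i)) * q t \<partial>bernoulli_pmf \<pi>1)
            = ennreal (likelihood True (X i)) * q True * ennreal \<pi>1
              + ennreal (likelihood False (X i)) * q False * ennreal (1 - \<pi>1)"
          using \<pi>1 by simp
        also have "\<dots> = (ennreal (likelihood False (X i)) * ennreal (1 - \<pi>1)) * q False
            + (ennreal (likelihood True (X i)) * ennreal \<pi>1) * q True"
          by (simp only: ac_simps)
        finally show ?thesis using lik by (simp only:)
      qed
      have "(\<integral>\<^sup>+\<theta>. ?g \<theta> X * (\<Prod>j\<in>J. y (\<theta> j) (d j)) \<partial>labels n)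
          = (\<integral>\<^sup>+\<theta>. (\<Prod>i<n. ennreal (likelihood (\<theta> i) (X i)) * (if i \<in> J then y (\<theta> i) (d i) else 1)) \<partial>labels n)"
        by (subst JI) (simp add: prod.inter_restrict prod.distrib)
      also have "\<dots> = (\<Prod>i<n. \<integral>\<^sup>+t. ennreal (likelihood t (X i)) * (if i \<in> J then y t (d i) else 1) \<partial>bernoulli_pmf \<pi>1)"
        by (rule nn_integral_prod_Pi_pmf) simp
      \<comment> \<open>For indices outside \<open>J\<close>, \<open>one\<close> with the constant
        loss 1 gives total posterior mass 1.\<close>
      also have "\<dots> = (\<Prod>i<n. if i \<in> J
          then ennreal (W (X i)) * y False (d i) + ennreal (1 - W (X i)) * y True (d i) else 1)"
      proof (rule prod.cong[OF refl])
        fix i assume "i \<in> {..<n}"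
        then have "i < n" by simp
        then show "(\<integral>\<^sup>+t. ennreal (likelihood t (X i)) * (if i \<in> J then y t (d i) else 1) \<partial>bernoulli_pmf \<pi>1)
          = (if i \<in> J then ennreal (W (X i)) * y False (d i) + ennreal (1 - W (X i)) * y True (d i) else 1)"
          using W_in[OF XM] one[of i "\<lambda>_. 1"] one[of i "\<lambda>t. y t (d i)"]
          by (auto simp flip: ennreal_plus)
      qed
      also have "\<dots> = (\<Prod>j\<in>J. ennreal (W (X j)) * y False (d j) + ennreal (1 - W (X j)) * y True (d j))"
        by (subst (2) JI) (simp add: prod.inter_restrict)
      finally show "(\<integral>\<^sup>+\<theta>. ?g \<theta> X * (\<Prod>j\<in>J. y (\<theta> j) (d j)) \<partial>labels n)
          = (\<Prod>j\<in>J. ennreal (W (X j)) * y False (d j) + ennreal (1 - W (X j)) * y True (d j))" .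
    qed
    finally show "(\<Sum>\<theta>\<in>set_pmf (labels n). ?g \<theta> X * ?H \<theta> X * pmf (labels n) \<theta>)
        = (\<integral>\<^sup>+d. (\<Prod>j\<in>J. ennreal (W (X j)) * y False (d j) + ennreal (1 - W (X j)) * y True (d j)) \<partial>\<delta> X)" .
  qed
  finally show ?thesis .
qed

end

end

section \<open>Losses of decision rules\<close>

lemma measurable_W_law_iff: "g \<in> borel_measurable (W_law M f0 f1 \<pi>0 \<pi>1) \<longleftrightarrow> g \<in> borel_measurable borel"
  by (simp add: W_law_def)

context two_group
begin

lemma real_distribution_W: "real_distribution \<mu>"
proof -
  interpret N: prob_space N by (rule prob_space_N)
  show ?thesis unfolding W_law_def by (intro N.real_distribution_distr) simp
qed

lemma W_law_range: "AE w in \<mu>. w \<in> {0..1}"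
proof -
  have "AE x in N. W x \<in> {0..1}" using W_in by (intro AE_I2) simp
  then show ?thesis unfolding W_law_def by (subst AE_distr_iff) simp_all
qed

lemma nn_integral_W_law:
  "g \<in> borel_measurable borel \<Longrightarrow> (\<integral>\<^sup>+w. g w \<partial>\<mu>) = (\<integral>\<^sup>+x. g (W x) \<partial>N)"
  unfolding W_law_def by (rule nn_integral_distr) simp_all

text \<open>Given the observations and the decision, the expected loss is the posterior average of
  \<open>y\<close>, which \<open>k (W (X i))\<close> bounds below for either decision. However the
  rule uses the other observations, only the marginal law of \<open>X i\<close> matters for this
  bound.\<close>

lemma expectation_loss_ge:
  assumes \<delta>: "\<delta> \<in> decision_rules M n" and i: "i < n"
    and y: "\<And>t s. 0 \<le> y t s"
    and k[measurable]: "k \<in> borel_measurable borel"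
    and k_nonneg: "\<And>w. w \<in> {0..1} \<Longrightarrow> 0 \<le> k w"
    and k_le: "\<And>w s. w \<in> {0..1} \<Longrightarrow> k w \<le> w * y False s + (1 - w) * y True s"
  shows "(\<integral>w. k w \<partial>\<mu>) \<le> (\<integral>z. y (fst (fst z) i) (snd z i) \<partial>D n \<delta>)"
proof -
  interpret D: prob_space "D n \<delta>" by (rule prob_space_D[OF \<delta>])
  interpret mu: real_distribution \<mu> by (rule real_distribution_W)
  define b where "b = y False False + y False True + y True False + y True True"
  have y_le: "y t s \<le> b" for t s
    using y[of False False] y[of False True] y[of True False] y[of True True]
    by (cases t; cases s) (auto simp: b_def)
  have k_le_b: "k w \<le> b" if "w \<in> {0..1}" for w
  proof -
    note k_le[OF that, of True]
    also have "w * y False True + (1 - w) * y True True \<le> w * b + (1 - w) * b"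
      using that by (intro add_mono mult_left_mono y_le) auto
    finally show ?thesis by (simp add: algebra_simps)
  qed
  let ?P = "\<Pi>\<^sub>M i\<in>{..<n}. N"
  have setsP: "sets ?P = sets (\<Pi>\<^sub>M i\<in>{..<n}. M)" by (intro sets_PiM_cong) auto
  have "(\<integral>\<^sup>+w. ennreal (k w) \<partial>\<mu>) = (\<integral>\<^sup>+x. ennreal (k (W x)) \<partial>N)"
    by (rule nn_integral_W_law) simp
  also have "\<dots> = (\<integral>\<^sup>+x. ennreal (k (W x)) \<partial>distr ?P N (\<lambda>X. X i))"
    using i by (subst distr_PiM_component) (auto simp: prob_space_N)
  also have "\<dots> = (\<integral>\<^sup>+X. ennreal (k (W (X i))) \<partial>?P)"
    using i by (intro nn_integral_distr measurable_component_singleton) auto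
  also have "\<dots> \<le> (\<integral>\<^sup>+X. \<integral>\<^sup>+d. (\<Prod>j\<in>{i}. ennreal (W (X j)) * ennreal (y False (d j))
      + ennreal (1 - W (X j)) * ennreal (y True (d j))) \<partial>\<delta> X \<partial>?P)"
  proof (rule nn_integral_mono)
    fix X assume X: "X \<in> space ?P"
    then have Xi: "W (X i) \<in> {0..1}" using i by (intro W_in) (auto simp: space_PiM PiE_iff)
    have "prob_space (\<delta> X)"
      using measurable_space[OF rule_kernel[OF \<delta>]] X sets_eq_imp_space_eq[OF setsP]
      by (auto simp: space_prob_algebra)
    then have "ennreal (k (W (X i))) = (\<integral>\<^sup>+d. ennreal (k (W (X i))) \<partial>\<delta> X)"
      by (simp add: prob_space.emeasure_space_1)
    also have "\<dots> \<le> (\<integral>\<^sup>+d. (\<Prod>j\<in>{i}. ennreal (W (X j)) * ennreal (y False (d j))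
      + ennreal (1 - W (X j)) * ennreal (y True (d j))) \<partial>\<delta> X)"
      using Xi k_le[OF Xi] y
      by (intro nn_integral_mono) (auto simp flip: ennreal_mult ennreal_plus intro!: ennreal_leI)
    finally show "ennreal (k (W (X i))) \<le> \<dots>" .
  qed
  also have "\<dots> = (\<integral>\<^sup>+z. (\<Prod>j\<in>{i}. ennreal (y (fst (fst z) j) (snd z j))) \<partial>D n \<delta>)"
    using i by (subst nn_integral_D_posterior[OF \<delta>, of "{i}" "\<lambda>t s. ennreal (y t s)"]) auto
  also have "\<dots> = (\<integral>\<^sup>+z. ennreal (y (fst (fst z) i) (snd z i)) \<partial>D n \<delta>)" by simp
  also have "\<dots> = ennreal (\<integral>z. y (fst (fst z) i) (snd z i) \<partial>D n \<delta>)"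
    using y y_le i by (intro nn_integral_eq_integral D.integrable_const_bound[where B = b] measurable_loss[OF \<delta>]) auto
  also have "(\<integral>\<^sup>+w. ennreal (k w) \<partial>\<mu>) = ennreal (\<integral>w. k w \<partial>\<mu>)"
    using W_law_range k_nonneg k_le_b
    by (intro nn_integral_eq_integral mu.integrable_const_bound[where B = b]) (auto simp: measurable_W_law_iff)
  finally show ?thesis
    by (subst (asm) ennreal_le_iff) (auto intro!: Bochner_Integration.integral_nonneg y)
qed

lemma measurable_criteria:
  assumes "\<delta> \<in> decision_rules M n"
  shows "(\<lambda>z. rejections n (snd z)) \<in> borel_measurable (D n \<delta>)"
    and "(\<lambda>z. false_rejections n (fst (fst z)) (snd z)) \<in> borel_measurable (D n \<delta>)"
    and "(\<lambda>z. FDP n (fst (fst z)) (snd z)) \<in> borel_measurable (D n \<delta>)"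
    and "(\<lambda>z. FN n (fst (fst z)) (snd z)) \<in> borel_measurable (D n \<delta>)"
proof -
  note loss = measurable_loss[OF assms, of _ "\<lambda>t s. of_bool s :: real"]
    measurable_loss[OF assms, of _ "\<lambda>t s. of_bool s * (1 - of_bool t) :: real"]
    measurable_loss[OF assms, of _ "\<lambda>t s. of_bool t * (1 - of_bool s) :: real"]
  show [measurable]: "(\<lambda>z. rejections n (snd z)) \<in> borel_measurable (D n \<delta>)"
    "(\<lambda>z. false_rejections n (fst (fst z)) (snd z)) \<in> borel_measurable (D n \<delta>)"
    unfolding rejections_def false_rejections_def by (intro borel_measurable_sum loss; simp)+
  show "(\<lambda>z. FDP n (fst (fst z)) (snd z)) \<in> borel_measurable (D n \<delta>)"
    unfolding FDP_def by measurable
  show "(\<lambda>z. FN n (fst (fst z)) (snd z)) \<in> borel_measurable (D n \<delta>)"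
    unfolding FN_def by (intro borel_measurable_times borel_measurable_const borel_measurable_sum loss) simp
qed

end

section \<open>First and second moments under the Neyman-Pearson rule\<close>

locale two_group_np = two_group M f0 f1 \<pi>0 \<pi>1
  for M :: "'a measure" and f0 f1 \<pi>0 \<pi>1 +
  fixes p :: "real \<Rightarrow> real" and \<alpha> :: real
  assumes rand: "randomization (W_law M f0 f1 \<pi>0 \<pi>1) p" and level: "\<alpha> \<in> {0..1}"
begin

sublocale np: np_setting "W_law M f0 f1 \<pi>0 \<pi>1" p \<alpha>
  using real_distribution_W W_law_range rand level
  by (simp add: np_setting_def np_setting_axioms_def)

abbreviation "NP \<equiv> np_rule M f0 f1 \<pi>0 \<pi>1 p \<alpha>"
abbreviation "test \<equiv> np_test \<mu> p np.ustar"

lemma NP_in_rules: "NP n \<in> decision_rules M n"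
proof -
  have "(\<lambda>X. \<Pi>\<^sub>M i\<in>{..<n}. measure_pmf (test (W (X i))))
      \<in> (\<Pi>\<^sub>M i\<in>{..<n}. M) \<rightarrow>\<^sub>M prob_algebra (\<Pi>\<^sub>M i\<in>{..<n}. count_space UNIV)"
  proof (rule measurable_PiM_kernel)
    fix i assume "i \<in> {..<n}"
    then show "(\<lambda>X. measure_pmf (test (W (X i)))) \<in> (\<Pi>\<^sub>M i\<in>{..<n}. M) \<rightarrow>\<^sub>M prob_algebra (count_space UNIV)"
      by (intro measurable_compose[OF _ np_test_kernel] measurable_compose[OF _ measurable_densities(4)]
          measurable_component_singleton)
  qed (auto simp: measure_pmf.prob_space_axioms)
  then show ?thesis unfolding decision_rules_def decision_space_def np_rule_def Let_def .
qed

text \<open>The expected loss of one test under the Neyman-Pearson rule: \<open>accept\<close>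
  averages over the decision, \<open>w\<close> over the label, and \<open>\<mu>\<close> over the
  observation.\<close>

definition risk :: "(bool \<Rightarrow> bool \<Rightarrow> real) \<Rightarrow> real"
  where "risk y = (\<integral>w. np.accept np.ustar w * (w * y False True + (1 - w) * y True True)
    + (1 - np.accept np.ustar w) * (w * y False False + (1 - w) * y True False) \<partial>\<mu>)"

text \<open>The rule treats each coordinate by itself with its own coin. Once the labels are
  integrated out, the integrand factorizes first over the coins and then over the iid observations,
  and every factor is the same.\<close>

lemma nn_integral_NP:
  assumes y: "\<And>t s. 0 \<le> y t s" and J: "J \<subseteq> {..<n}"
  shows "(\<integral>\<^sup>+z. (\<Prod>j\<in>J. ennreal (y (fst (fst z) j) (snd z j))) \<partial>D n (NP n)) = ennreal (risk y) ^ card J"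
proof -
  let ?q = "\<lambda>w s. ennreal w * ennreal (y False s) + ennreal (1 - w) * ennreal (y True s)"
  let ?r = "\<lambda>w. \<integral>\<^sup>+s. ?q w s \<partial>measure_pmf (test w)"
  have q[measurable]: "(\<lambda>(w, s). ?q w s) \<in> borel_measurable (borel \<Otimes>\<^sub>M count_space UNIV)"
  proof -
    have [measurable]: "(\<lambda>z. ennreal (y t (snd z))) \<in> borel_measurable (borel \<Otimes>\<^sub>M count_space UNIV)" for t
      by (rule measurable_compose[OF measurable_snd]) simp
    show ?thesis unfolding case_prod_unfold by measurable
  qed
  have r[measurable]: "?r \<in> borel_measurable borel"
    by (rule nn_integral_measurable_subprob_algebra2[OF q measurable_prob_algebraD[OF np_test_kernel]])
  have "(\<integral>\<^sup>+z. (\<Prod>j\<in>J. ennreal (y (fst (fst z) j) (snd z j))) \<partial>D n (NP n))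
      = (\<integral>\<^sup>+X. \<integral>\<^sup>+d. (\<Prod>j\<in>J. ?q (W (X j)) (d j)) \<partial>NP n X \<partial>(\<Pi>\<^sub>M i\<in>{..<n}. N))"
    by (rule nn_integral_D_posterior[OF NP_in_rules J])
  also have "\<dots> = (\<integral>\<^sup>+X. (\<Prod>j\<in>J. ?r (W (X j))) \<partial>(\<Pi>\<^sub>M i\<in>{..<n}. N))"
    unfolding np_rule_def Let_def
    by (intro nn_integral_cong nn_integral_PiM_prod_subset J) (auto simp: measure_pmf.prob_space_axioms)
  also have "\<dots> = (\<Prod>j\<in>J. \<integral>\<^sup>+x. ?r (W x) \<partial>N)"
    by (intro nn_integral_PiM_prod_subset[where f = "\<lambda>_ x. ?r (W x)"] J)
      (auto simp: prob_space_N intro!: measurable_compose[OF measurable_densities(4) r])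
  also have "(\<integral>\<^sup>+x. ?r (W x) \<partial>N) = (\<integral>\<^sup>+w. ?r w \<partial>\<mu>)"
    by (rule nn_integral_W_law[OF r, symmetric])
  also have "\<dots> = ennreal (risk y)"
  proof -
    let ?R = "\<lambda>w. np.accept np.ustar w * (w * y False True + (1 - w) * y True True)
      + (1 - np.accept np.ustar w) * (w * y False False + (1 - w) * y True False)"
    have eq: "?r w = ennreal (?R w)" if w: "w \<in> {0..1}" for w
    proof -
      have q: "?q w s = ennreal (w * y False s + (1 - w) * y True s)" for s
        using w y by (simp add: ennreal_mult ennreal_plus)
      have nn: "0 \<le> w * y False s + (1 - w) * y True s" for s using w y by simp
      have "?r w = ?q w True * pmf (test w) True + ?q w False * pmf (test w) False"
        by (subst nn_integral_measure_pmf_support[of UNIV]) (auto simp: UNIV_bool add.commute)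
      also have "pmf (test w) False = 1 - np.accept np.ustar w"
        by (simp add: np.accept_def pmf_False_conv_True)
      finally show ?thesis unfolding q using nn np.accept_nonneg np.accept_le_1
        by (simp add: np.accept_def[symmetric] mult.commute ennreal_mult ennreal_plus)
    qed
    define b where "b = y False True + y True True + y False False + y True False"
    have R: "0 \<le> ?R w \<and> ?R w \<le> b" if w: "w \<in> {0..1}" for w
    proof
      note a = np.accept_nonneg[of np.ustar w] np.accept_le_1[of np.ustar w]
      show "0 \<le> ?R w" using w y a by simp
      have mix: "s * u + (1 - s) * v \<le> u + v" if "0 \<le> s" "s \<le> 1" "0 \<le> u" "0 \<le> v" for s u v :: real
        using that by (intro add_mono mult_left_le_one_le) auto
      have "?R w \<le> (w * y False True + (1 - w) * y True True) + (w * y False False + (1 - w) * y True False)"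
        using w y a by (intro mix) auto
      also have "\<dots> \<le> (y False True + y True True) + (y False False + y True False)"
        using w y by (intro add_mono mix) auto
      finally show "?R w \<le> b" by (simp add: b_def)
    qed
    have "(\<integral>\<^sup>+w. ?r w \<partial>\<mu>) = (\<integral>\<^sup>+w. ennreal (?R w) \<partial>\<mu>)"
      using W_law_range by (intro nn_integral_cong_AE) (auto simp: eq simp del: atLeastAtMost_iff)
    also have "\<dots> = ennreal (risk y)"
      unfolding risk_def
    proof (rule nn_integral_eq_integral)
      show "integrable \<mu> ?R" using R by (intro np.integrable_unit[where b = b]) auto
      show "AE w in \<mu>. 0 \<le> ?R w" using W_law_range R by auto
    qed
    finally show ?thesis .
  qed
  finally show ?thesis by simp
qed

lemma risk_nonneg: "(\<And>t s. 0 \<le> y t s) \<Longrightarrow> 0 \<le> risk y"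
  unfolding risk_def using W_law_range
  by (intro integral_nonneg_AE) (auto simp: np.accept_nonneg np.accept_le_1)

lemma expectation_NP:
  assumes y: "\<And>t s. 0 \<le> y t s"
  shows expectation_NP_single: "i < n \<Longrightarrow> (\<integral>z. y (fst (fst z) i) (snd z i) \<partial>D n (NP n)) = risk y"
    and expectation_NP_pair: "i < n \<Longrightarrow> j < n \<Longrightarrow> i \<noteq> j \<Longrightarrow>
      (\<integral>z. y (fst (fst z) i) (snd z i) * y (fst (fst z) j) (snd z j) \<partial>D n (NP n)) = risk y * risk y"
proof -
  note loss = measurable_loss[OF NP_in_rules, of _ _ y]
  show "(\<integral>z. y (fst (fst z) i) (snd z i) \<partial>D n (NP n)) = risk y" if "i < n"
    using nn_integral_NP[of y "{i}" n] that y risk_nonneg[of y]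
    by (subst integral_eq_nn_integral) (auto simp: loss)
  show "(\<integral>z. y (fst (fst z) i) (snd z i) * y (fst (fst z) j) (snd z j) \<partial>D n (NP n)) = risk y * risk y"
    if "i < n" "j < n" "i \<noteq> j"
    using nn_integral_NP[of y "{i, j}" n] that y risk_nonneg[of y]
    by (subst integral_eq_nn_integral)
      (auto simp: loss ennreal_mult power2_eq_square enn2real_mult intro!: borel_measurable_times)
qed

end

section \<open>Elementary relations between the counts\<close>

context two_group
begin

lemma integrable_loss:
  fixes y :: "bool \<Rightarrow> bool \<Rightarrow> real"
  assumes \<delta>: "\<delta> \<in> decision_rules M n" and i: "i < n"
  shows "integrable (D n \<delta>) (\<lambda>z. y (fst (fst z) i) (snd z i))"
proof -
  interpret D: prob_space "D n \<delta>" by (rule prob_space_D[OF \<delta>])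
  have "\<bar>y t s\<bar> \<le> \<bar>y False False\<bar> + \<bar>y False True\<bar> + \<bar>y True False\<bar> + \<bar>y True True\<bar>" for t s
    by (cases t; cases s) auto
  then show ?thesis
    by (intro D.integrable_const_bound[OF AE_I2] measurable_loss[OF \<delta> i]) simp
qed

lemma false_rejections_le:
  shows "0 \<le> false_rejections n \<theta> d"
    and "false_rejections n \<theta> d \<le> rejections n d"
    and "rejections n d \<le> n"
proof -
  show "0 \<le> false_rejections n \<theta> d"
    unfolding false_rejections_def by (intro sum_nonneg) simp
  show "false_rejections n \<theta> d \<le> rejections n d"
    unfolding false_rejections_def rejections_def by (intro sum_mono) simp
  have "rejections n d \<le> (\<Sum>i<n. 1)" unfolding rejections_def by (intro sum_mono) simp
  then show "rejections n d \<le> n" by simp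
qed

text \<open>The number of rejections is an integer: if it is nonzero, it is at least 1 and the
  maximum in \<open>FDP\<close> is inactive; if it is zero, so are the false rejections.\<close>

lemma FDP_mult: "FDP n \<theta> d * rejections n d = false_rejections n \<theta> d"
proof (cases "rejections n d = 0")
  case True
  then show ?thesis using false_rejections_le(1,2)[of n \<theta> d] by simp
next
  case False
  obtain k :: nat where "rejections n d = k" by (simp add: rejections_def)
  with False have "1 \<le> rejections n d" by (cases k) auto
  then show ?thesis by (simp add: FDP_def)
qed

lemma integrable_criteria:
  assumes "\<delta> \<in> decision_rules M n"
  shows "integrable (D n \<delta>) (\<lambda>z. rejections n (snd z))"
    and "integrable (D n \<delta>) (\<lambda>z. false_rejections n (fst (fst z)) (snd z))"
    and "integrable (D n \<delta>) (\<lambda>z. FN n (fst (fst z)) (snd z))"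
  unfolding rejections_def false_rejections_def FN_def
  using integrable_loss[OF assms, of _ "\<lambda>t s. of_bool s"]
    integrable_loss[OF assms, of _ "\<lambda>t s. of_bool s * (1 - of_bool t)"]
    integrable_loss[OF assms, of _ "\<lambda>t s. of_bool t * (1 - of_bool s)"]
  by (intro Bochner_Integration.integrable_sum integrable_mult_right; simp)+

end

section \<open>The lower bound for EFN and the value of \<open>mEFN_star\<close>\<close>

context two_group_np
begin

abbreviation "excess n \<delta> \<equiv>
  (\<integral>z. false_rejections n (fst (fst z)) (snd z) - \<alpha> * rejections n (snd z) \<partial>D n \<delta>) / real n"

text \<open>Weak duality, summed over the coordinates. The multiplier depends on
  \<open>\<eta>\<close> but on neither \<open>n\<close> nor the rule, so that it stays fixed when
  \<open>n\<close> tends to infinity in the converse.\<close>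

lemma EFN_lower_bound:
  assumes "0 < \<eta>"
  shows "\<exists>L\<ge>0. \<forall>n\<ge>1. \<forall>\<delta>\<in>decision_rules M n.
      np.miss np.ustar - \<eta> \<le> EFN M f0 f1 \<pi>1 n \<delta> + L * excess n \<delta>"
proof -
  obtain L where L: "0 \<le> L" "np.miss np.ustar - \<eta> + L * \<alpha> \<le> (\<integral>w. min (1 - w + L * \<alpha>) (L * w) \<partial>\<mu>)"
    using np.dual_certificate[OF \<open>0 < \<eta>\<close>] .
  have "np.miss np.ustar - \<eta> \<le> EFN M f0 f1 \<pi>1 n \<delta> + L * excess n \<delta>"
    if n: "1 \<le> n" and \<delta>: "\<delta> \<in> decision_rules M n" for n \<delta>
  proof -
    interpret D: prob_space "D n \<delta>" by (rule prob_space_D[OF \<delta>])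
    \<comment> \<open>The Lagrangian loss, shifted by \<open>L * \<alpha>\<close> to be nonnegative.
      Its posterior average is \<open>L * w\<close> for a rejection and
      \<open>1 - w + L * \<alpha>\<close> otherwise, exactly the two terms of the minimum.\<close>
    define y :: "bool \<Rightarrow> bool \<Rightarrow> real" where
      "y t s = of_bool t * (1 - of_bool s) + L * (of_bool s * (1 - of_bool t)) - L * \<alpha> * of_bool s + L * \<alpha>" for t s
    have y0: "0 \<le> y t s" for t s using L(1) level by (cases t; cases s) (auto simp: y_def)
    have sum_y: "(\<Sum>i<n. y (\<theta> i) (d i))
        = n * FN n \<theta> d + L * (false_rejections n \<theta> d - \<alpha> * rejections n d) + n * (L * \<alpha>)" for \<theta> d
      using n by (simp only: y_def FN_def false_rejections_def rejections_def sum.distrib sum_subtractf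
          sum_distrib_left[symmetric]) (simp add: algebra_simps)
    have "n * (np.miss np.ustar - \<eta> + L * \<alpha>) \<le> (\<Sum>i<n. \<integral>w. min (1 - w + L * \<alpha>) (L * w) \<partial>\<mu>)"
      using L(2) by (simp add: mult_left_mono)
    also have "\<dots> \<le> (\<Sum>i<n. \<integral>z. y (fst (fst z) i) (snd z i) \<partial>D n \<delta>)"
    proof (intro sum_mono expectation_loss_ge[OF \<delta> _ y0])
      fix w :: real and s assume w: "w \<in> {0..1}"
      show "min (1 - w + L * \<alpha>) (L * w) \<le> w * y False s + (1 - w) * y True s"
        by (cases s) (auto simp: y_def min_le_iff_disj algebra_simps)
      show "0 \<le> min (1 - w + L * \<alpha>) (L * w)" using w L(1) level by auto
    qed auto
    also have "\<dots> = (\<integral>z. (\<Sum>i<n. y (fst (fst z) i) (snd z i)) \<partial>D n \<delta>)"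
      using integrable_loss[OF \<delta>] by (subst Bochner_Integration.integral_sum) auto
    also have "\<dots> = n * EFN M f0 f1 \<pi>1 n \<delta>
        + L * (\<integral>z. false_rejections n (fst (fst z)) (snd z) - \<alpha> * rejections n (snd z) \<partial>D n \<delta>) + n * (L * \<alpha>)"
      unfolding sum_y EFN_def case_prod_unfold using integrable_criteria[OF \<delta>] D.prob_space by simp
    finally have "n * (np.miss np.ustar - \<eta>) \<le> n * (EFN M f0 f1 \<pi>1 n \<delta>
        + L * excess n \<delta>)"
      using n by (simp add: algebra_simps)
    then show ?thesis using n by (simp add: mult_le_cancel_left)
  qed
  with L(1) show ?thesis by blast
qed

text \<open>The first three losses count rejections, false rejections and missed signals. The last
  one sums to the false rejections plus \<open>c\<close> times the acceptances, the linear form in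
  which \<open>NP_FDP\<close> handles the ratio.\<close>

lemma risk_rejection: "risk (\<lambda>t s. of_bool s) = np.ustar"
  and risk_false_rejection: "risk (\<lambda>t s. of_bool s * (1 - of_bool t)) = np.I np.ustar"
  and risk_missed: "risk (\<lambda>t s. of_bool t * (1 - of_bool s)) = np.miss np.ustar"
  and risk_false_excess:
    "risk (\<lambda>t s. of_bool s * (1 - of_bool t) + c * (1 - of_bool s)) = np.I np.ustar + c * (1 - np.ustar)"
proof -
  have "np.prob UNIV = 1" using np.prob_space by simp
  note int = this np.integrable_basic np.integral_accept[OF np.ustar_in]
  show "risk (\<lambda>t s. of_bool s) = np.ustar"
    by (simp add: risk_def int)
  show "risk (\<lambda>t s. of_bool s * (1 - of_bool t)) = np.I np.ustar"
    by (simp add: risk_def np.I_def)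
  show "risk (\<lambda>t s. of_bool t * (1 - of_bool s)) = np.miss np.ustar"
    by (simp add: risk_def np.miss_def)
  have "risk (\<lambda>t s. of_bool s * (1 - of_bool t) + c * (1 - of_bool s))
      = (\<integral>w. np.accept np.ustar w * w + c * (1 - np.accept np.ustar w) \<partial>\<mu>)"
    unfolding risk_def by (intro Bochner_Integration.integral_cong) (auto simp: algebra_simps)
  then show "risk (\<lambda>t s. of_bool s * (1 - of_bool t) + c * (1 - of_bool s)) = np.I np.ustar + c * (1 - np.ustar)"
    by (simp add: int np.I_def)
qed

lemma expectation_NP_sum:
  assumes "\<And>t s. 0 \<le> y t s"
  shows "(\<integral>z. (\<Sum>i<n. y (fst (fst z) i) (snd z i)) \<partial>D n (NP n)) = n * risk y"
  using integrable_loss[OF NP_in_rules] expectation_NP_single[of y, OF assms]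
  by (subst Bochner_Integration.integral_sum) auto

lemma EFN_NP: "1 \<le> n \<Longrightarrow> EFN M f0 f1 \<pi>1 n (NP n) = np.miss np.ustar"
  using expectation_NP_sum[of "\<lambda>t s. of_bool t * (1 - of_bool s)" n]
  by (simp add: EFN_def FN_def case_prod_unfold risk_missed)

lemma mFDR_NP: "mFDR M f0 f1 \<pi>1 n (NP n) \<le> \<alpha>"
proof -
  have "mFDR M f0 f1 \<pi>1 n (NP n) = n * np.I np.ustar / (n * np.ustar)"
    using expectation_NP_sum[of "\<lambda>t s. of_bool s * (1 - of_bool t)" n]
      expectation_NP_sum[of "\<lambda>t s. of_bool s" n]
    by (simp only: mFDR_def false_rejections_def rejections_def case_prod_unfold
        risk_false_rejection risk_rejection) simp
  also have "\<dots> \<le> \<alpha>"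
    using np.I_ustar np.ustar_in level by (cases "n = 0 \<or> np.ustar = 0") (auto simp: divide_le_eq)
  finally show ?thesis .
qed

text \<open>The Neyman-Pearson rule is feasible and attains the value. For any feasible rule
  \<open>excess\<close> is at most 0, so the lower bound holds up to an arbitrary
  \<open>\<eta>\<close>.\<close>

lemma mEFN_star_eq:
  assumes m: "1 \<le> m"
  shows "mEFN_star M f0 f1 \<pi>1 m \<alpha> = np.miss np.ustar"
proof -
  define R where "R = {EFN M f0 f1 \<pi>1 m \<delta> | \<delta>. \<delta> \<in> decision_rules M m \<and> mFDR M f0 f1 \<pi>1 m \<delta> \<le> \<alpha>}"
  have ge: "np.miss np.ustar \<le> EFN M f0 f1 \<pi>1 m \<delta>"
    if \<delta>: "\<delta> \<in> decision_rules M m" and le: "mFDR M f0 f1 \<pi>1 m \<delta> \<le> \<alpha>" for \<delta>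
  proof (rule field_le_epsilon)
    fix \<eta> :: real assume "0 < \<eta>"
    let ?V = "\<integral>z. false_rejections m (fst (fst z)) (snd z) \<partial>D m \<delta>" and ?R = "\<integral>z. rejections m (snd z) \<partial>D m \<delta>"
    obtain L where L: "0 \<le> L" "\<forall>n\<ge>1. \<forall>\<delta>\<in>decision_rules M n.
        np.miss np.ustar - \<eta> \<le> EFN M f0 f1 \<pi>1 n \<delta> + L * excess n \<delta>"
      using EFN_lower_bound[OF \<open>0 < \<eta>\<close>] by blast
    have "?V \<le> ?R"
      by (intro integral_mono integrable_criteria[OF \<delta>] false_rejections_le)
    moreover have "0 \<le> ?R"
      using order_trans[OF false_rejections_le(1,2)] by (intro Bochner_Integration.integral_nonneg) blast
    \<comment> \<open>If \<open>?R\<close> is 0, the quotient in \<open>mFDR\<close> has its default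
      value and says nothing about \<open>?V\<close>; then \<open>?V \<le> ?R\<close> gives the
      claim.\<close>
    ultimately have "?V \<le> \<alpha> * ?R"
      using le by (cases "?R = 0") (auto simp: mFDR_def case_prod_unfold divide_le_eq)
    then have "excess m \<delta> \<le> 0"
      using integrable_criteria[OF \<delta>] by (intro divide_nonpos_nonneg) auto
    then have "L * excess m \<delta> \<le> 0" by (rule mult_nonneg_nonpos[OF L(1)])
    then show "np.miss np.ustar \<le> EFN M f0 f1 \<pi>1 m \<delta> + \<eta>" using L(2)[rule_format, OF m \<delta>] by linarith
  qed
  have mem: "np.miss np.ustar \<in> R"
    using EFN_NP[OF m] mFDR_NP NP_in_rules unfolding R_def by force
  have lower: "np.miss np.ustar \<le> x" if "x \<in> R" for x
    using that ge unfolding R_def by blast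
  then have "Inf R \<le> np.miss np.ustar" by (intro cInf_lower[OF mem] bdd_belowI)
  moreover have "np.miss np.ustar \<le> Inf R" using mem lower by (intro cInf_greatest) auto
  ultimately show ?thesis by (simp add: mEFN_star_def R_def)
qed

section \<open>Achievability\<close>

text \<open>Failure of \<open>Q\<close> forces the total loss to exceed its mean by at least
  \<open>n * t\<close>, which has probability at most \<open>b\<^sup>2 / (n * t\<^sup>2)\<close> by
  Chebyshev. Both error criteria are brought to this form.\<close>

lemma NP_concentration:
  assumes y: "\<And>t s. 0 \<le> y t s" and y_le: "\<And>t s. y t s \<le> b" and "0 < t"
    and Q: "\<And>n. {z \<in> space (D n (NP n)). Q n (fst (fst z)) (snd z)} \<in> sets (D n (NP n))"
    and imp: "\<And>n \<theta> d. 0 < n \<Longrightarrow> \<not> Q n \<theta> d \<Longrightarrow> n * (risk y + t) \<le> (\<Sum>i<n. y (\<theta> i) (d i))"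
  shows "(\<lambda>n. measure (D n (NP n)) {z \<in> space (D n (NP n)). Q n (fst (fst z)) (snd z)}) \<longlonglongrightarrow> 1"
proof (rule tendsto_sandwich)
  show "\<forall>\<^sub>F n in sequentially. measure (D n (NP n)) {z \<in> space (D n (NP n)). Q n (fst (fst z)) (snd z)} \<le> 1"
    using prob_space.prob_le_1[OF prob_space_D[OF NP_in_rules]] by simp
  show "\<forall>\<^sub>F n in sequentially. 1 - b\<^sup>2 / t\<^sup>2 * inverse (real n)
      \<le> measure (D n (NP n)) {z \<in> space (D n (NP n)). Q n (fst (fst z)) (snd z)}"
    using eventually_gt_at_top[of 0]
  proof eventually_elim
    fix n :: nat assume n: "0 < n"
    interpret D: prob_space "D n (NP n)" by (rule prob_space_D[OF NP_in_rules])
    let ?Y = "\<lambda>i z. y (fst (fst z) i) (snd z i)"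
    have [measurable]: "?Y i \<in> borel_measurable (D n (NP n))" if "i < n" for i
      by (rule measurable_loss[OF NP_in_rules that])
    have "1 - D.prob {z \<in> space (D n (NP n)). Q n (fst (fst z)) (snd z)}
        = D.prob (space (D n (NP n)) - {z \<in> space (D n (NP n)). Q n (fst (fst z)) (snd z)})"
      using Q by (simp add: D.prob_compl)
    also have "\<dots> \<le> D.prob {z \<in> space (D n (NP n)). real n * t \<le> \<bar>(\<Sum>i<n. ?Y i z) - real n * risk y\<bar>}"
      by (intro D.finite_measure_mono) (use imp[OF n] in \<open>force simp: distrib_left\<close>, measurable)
    also have "\<dots> \<le> b\<^sup>2 / (real n * t\<^sup>2)"
      using y y_le n \<open>0 < t\<close>
      by (intro D.sum_deviation_le expectation_NP_single expectation_NP_pair) auto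
    finally show "1 - b\<^sup>2 / t\<^sup>2 * inverse (real n)
        \<le> D.prob {z \<in> space (D n (NP n)). Q n (fst (fst z)) (snd z)}"
      by (simp add: field_simps)
  qed
  show "(\<lambda>n. 1 - b\<^sup>2 / t\<^sup>2 * inverse (real n)) \<longlonglongrightarrow> 1"
    using tendsto_diff[OF tendsto_const[of 1] tendsto_mult_right_zero[OF lim_inverse_n, of "b\<^sup>2 / t\<^sup>2"]] by simp
qed simp

text \<open>With \<open>c = \<alpha> + \<epsilon>\<close>, an FDP above \<open>c\<close> makes the
  false rejections plus \<open>c\<close> times the acceptances at least \<open>n * c\<close>. The
  mean of this sum is at most \<open>n * (c - \<epsilon> * ustar)\<close>, which leaves a positive
  gap unless \<open>ustar = 0\<close>.\<close>

lemma NP_FDP: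
  assumes "0 < \<epsilon>"
  shows "(\<lambda>n. measure (D n (NP n)) {z \<in> space (D n (NP n)). FDP n (fst (fst z)) (snd z) \<le> \<alpha> + \<epsilon>}) \<longlonglongrightarrow> 1"
proof (cases "np.ustar = 0")
  \<comment> \<open>With size 0 there is almost surely no rejection, hence the FDP is almost surely
    0 for every \<open>n\<close>.\<close>
  case True
  have "measure (D n (NP n)) {z \<in> space (D n (NP n)). FDP n (fst (fst z)) (snd z) \<le> \<alpha> + \<epsilon>} = 1" for n
  proof -
    interpret D: prob_space "D n (NP n)" by (rule prob_space_D[OF NP_in_rules])
    have "(\<integral>z. rejections n (snd z) \<partial>D n (NP n)) = 0"
      using expectation_NP_sum[of "\<lambda>t s. of_bool s" n] True
      by (simp only: rejections_def risk_rejection) simp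
    moreover have "0 \<le> rejections n d" for d by (auto simp: rejections_def intro: sum_nonneg)
    ultimately have "AE z in D n (NP n). rejections n (snd z) = 0"
      using integral_nonneg_eq_0_iff_AE[OF integrable_criteria(1)[OF NP_in_rules]] by auto
    moreover have "FDP n \<theta> d \<le> \<alpha> + \<epsilon>" if "rejections n d = 0" for \<theta> d
      using that false_rejections_le(1,2)[of n \<theta> d] level \<open>0 < \<epsilon>\<close> by (simp add: FDP_def)
    ultimately have "AE z in D n (NP n). FDP n (fst (fst z)) (snd z) \<le> \<alpha> + \<epsilon>" by auto
    then show ?thesis
      using measurable_criteria(3)[OF NP_in_rules] by (intro D.prob_Collect_eq_1[THEN iffD2]) auto
  qed
  then show ?thesis by simp
next
  case False
  then have pos: "0 < np.ustar" using np.ustar_in by simp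
  define c where "c = \<alpha> + \<epsilon>"
  have c: "0 \<le> c" using level \<open>0 < \<epsilon>\<close> by (simp add: c_def)
  show ?thesis
  proof (rule NP_concentration[where b = "1 + c" and t = "\<epsilon> * np.ustar"
        and y = "\<lambda>t s. of_bool s * (1 - of_bool t) + c * (1 - of_bool s)"])
    fix n :: nat and \<theta> d :: "nat \<Rightarrow> bool"
    assume "0 < n" and large: "\<not> FDP n \<theta> d \<le> \<alpha> + \<epsilon>"
    have "c * rejections n d \<le> false_rejections n \<theta> d"
      unfolding FDP_mult[symmetric, of n \<theta> d] using large order_trans[OF false_rejections_le(1,2)]
      by (intro mult_right_mono) (auto simp: c_def)
    then have "n * c \<le> false_rejections n \<theta> d + c * (n - rejections n d)" by (simp add: algebra_simps)
    also have "\<dots> = (\<Sum>i<n. of_bool (d i) * (1 - of_bool (\<theta> i)) + c * (1 - of_bool (d i)))"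
      by (simp only: sum.distrib sum_distrib_left[symmetric] sum_subtractf false_rejections_def rejections_def) simp
    finally have 1: "n * c \<le> \<dots>" .
    have "risk (\<lambda>t s. of_bool s * (1 - of_bool t) + c * (1 - of_bool s)) + \<epsilon> * np.ustar \<le> c"
      unfolding risk_false_excess using np.I_ustar by (simp add: c_def algebra_simps)
    then have "n * (risk (\<lambda>t s. of_bool s * (1 - of_bool t) + c * (1 - of_bool s)) + \<epsilon> * np.ustar) \<le> n * c"
      by (intro mult_left_mono) auto
    with 1 show "n * (risk (\<lambda>t s. of_bool s * (1 - of_bool t) + c * (1 - of_bool s)) + \<epsilon> * np.ustar)
      \<le> (\<Sum>i<n. of_bool (d i) * (1 - of_bool (\<theta> i)) + c * (1 - of_bool (d i)))" by linarith
  qed (use c pos \<open>0 < \<epsilon>\<close> measurable_criteria(3)[OF NP_in_rules] in auto)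
qed

lemma NP_FN:
  assumes "0 < \<epsilon>" and \<beta>: "np.miss np.ustar \<le> \<beta>"
  shows "(\<lambda>n. measure (D n (NP n)) {z \<in> space (D n (NP n)). FN n (fst (fst z)) (snd z) \<le> \<beta> + \<epsilon>}) \<longlonglongrightarrow> 1"
proof (rule NP_concentration[where b = 1 and t = \<epsilon> and y = "\<lambda>t s. of_bool t * (1 - of_bool s)"])
  fix n :: nat and \<theta> d :: "nat \<Rightarrow> bool"
  assume n: "0 < n" and large: "\<not> FN n \<theta> d \<le> \<beta> + \<epsilon>"
  have "n * (np.miss np.ustar + \<epsilon>) \<le> n * FN n \<theta> d"
    using large \<beta> by (intro mult_left_mono) auto
  then show "n * (risk (\<lambda>t s. of_bool t * (1 - of_bool s)) + \<epsilon>) \<le> (\<Sum>i<n. of_bool (\<theta> i) * (1 - of_bool (d i)))"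
    using n by (simp only: risk_missed FN_def) simp
qed (use \<open>0 < \<epsilon>\<close> measurable_criteria(4)[OF NP_in_rules] in auto)

text \<open>Since the excess count is at most \<open>n\<close> in general and at most 0 where FDP is
  controlled, \<open>excess\<close> is bounded by the probability that control fails. With
  \<open>L\<close> fixed first, the limit in \<open>n\<close> leaves only
  \<open>\<eta>\<close>.\<close>

lemma converse:
  assumes \<delta>: "\<And>n. 1 \<le> n \<Longrightarrow> \<delta> n \<in> decision_rules M n"
    and FDP: "(\<lambda>n. measure (D n (\<delta> n)) {z \<in> space (D n (\<delta> n)). FDP n (fst (fst z)) (snd z) \<le> \<alpha>}) \<longlonglongrightarrow> 1"
    and EFN: "\<And>n. 1 \<le> n \<Longrightarrow> EFN M f0 f1 \<pi>1 n (\<delta> n) \<le> \<beta>"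
  shows "np.miss np.ustar \<le> \<beta>"
proof (rule field_le_epsilon)
  fix \<eta> :: real assume "0 < \<eta>"
  let ?G = "\<lambda>n. {z \<in> space (D n (\<delta> n)). FDP n (fst (fst z)) (snd z) \<le> \<alpha>}"
  obtain L where L: "0 \<le> L" "\<forall>n\<ge>1. \<forall>\<delta>\<in>decision_rules M n.
      np.miss np.ustar - \<eta> \<le> EFN M f0 f1 \<pi>1 n \<delta> + L * excess n \<delta>"
    using EFN_lower_bound[OF \<open>0 < \<eta>\<close>] by blast
  have "np.miss np.ustar \<le> \<beta> + \<eta> + L * (1 - measure (D n (\<delta> n)) (?G n))" if n: "1 \<le> n" for n
  proof -
    interpret D: prob_space "D n (\<delta> n)" by (rule prob_space_D[OF \<delta>[OF n]])
    have G[measurable]: "?G n \<in> sets (D n (\<delta> n))"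
      using measurable_criteria(3)[OF \<delta>[OF n]] by measurable
    have int_G: "integrable (D n (\<delta> n)) (indicator (?G n) :: _ \<Rightarrow> real)"
      using G by (simp add: integrable_indicator_iff D.emeasure_eq_measure)
    have "(\<integral>z. false_rejections n (fst (fst z)) (snd z) - \<alpha> * rejections n (snd z) \<partial>D n (\<delta> n))
        \<le> (\<integral>z. real n * (1 - indicator (?G n) z) \<partial>D n (\<delta> n))"
    proof (rule integral_mono)
      fix z assume z: "z \<in> space (D n (\<delta> n))"
      let ?R = "rejections n (snd z)" and ?V = "false_rejections n (fst (fst z)) (snd z)"
      have "0 \<le> ?R" "0 \<le> ?V" "?V \<le> ?R" "?R \<le> n"
        using order_trans[OF false_rejections_le(1,2)] false_rejections_le by auto
      moreover have "?V \<le> \<alpha> * ?R" if "FDP n (fst (fst z)) (snd z) \<le> \<alpha>"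
        using mult_right_mono[OF that \<open>0 \<le> ?R\<close>] by (simp add: FDP_mult)
      moreover have "0 \<le> \<alpha> * ?R" using level \<open>0 \<le> ?R\<close> by simp
      ultimately show "?V - \<alpha> * ?R \<le> real n * (1 - indicator (?G n) z)"
        using z by (auto simp: indicator_def)
    qed (use integrable_criteria[OF \<delta>[OF n]] int_G in \<open>auto intro!: Bochner_Integration.integrable_diff\<close>)
    also have "\<dots> = n * (1 - D.prob (?G n))"
      using D.prob_space G
      by (simp only: integral_mult_right_zero Bochner_Integration.integral_diff[OF D.integrable_const int_G]) simp
    finally have "excess n (\<delta> n) \<le> 1 - D.prob (?G n)" using n by (simp add: divide_le_eq mult.commute)
    then have "L * excess n (\<delta> n) \<le> L * (1 - D.prob (?G n))" using L(1) by (intro mult_left_mono)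
    with L(2)[rule_format, OF n \<delta>[OF n]] EFN[OF n] show ?thesis by linarith
  qed
  then have "\<forall>\<^sub>F n in sequentially. np.miss np.ustar \<le> \<beta> + \<eta> + L * (1 - measure (D n (\<delta> n)) (?G n))"
    using eventually_ge_at_top[of 1] by (rule eventually_mono[rotated])
  moreover have "(\<lambda>n. \<beta> + \<eta> + L * (1 - measure (D n (\<delta> n)) (?G n))) \<longlonglongrightarrow> \<beta> + \<eta> + L * (1 - 1)"
    by (intro tendsto_intros FDP)
  ultimately show "np.miss np.ustar \<le> \<beta> + \<eta>"
    using tendsto_lowerbound by fastforce
qed

end

theorem theorem17:
  fixes M :: "'a measure"
    and f0 f1 :: "'a \<Rightarrow> real"
    and \<pi>0 \<pi>1 \<alpha> :: real
    and p :: "real \<Rightarrow> real"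
    and m :: nat
  assumes "\<pi>0 \<in> {0<..<1}" and "\<pi>1 \<in> {0<..<1}" and "\<pi>0 + \<pi>1 = 1"
    and "prob_density M f0" and "prob_density M f1"
    and "randomization (W_law M f0 f1 \<pi>0 \<pi>1) p"
    and "\<alpha> \<in> {0..1}"
    and "m \<ge> 1"
  shows
    "(\<forall>\<beta> \<ge> mEFN_star M f0 f1 \<pi>1 m \<alpha>. \<forall>\<epsilon> > 0.
        (\<lambda>n. \<P>(((\<theta>, X), d) in decision_law M f0 f1 \<pi>1 n (np_rule M f0 f1 \<pi>0 \<pi>1 p \<alpha> n).
               FDP n \<theta> d \<le> \<alpha> + \<epsilon>)) \<longlonglongrightarrow> 1 \<and>
        (\<lambda>n. \<P>(((\<theta>, X), d) in decision_law M f0 f1 \<pi>1 n (np_rule M f0 f1 \<pi>0 \<pi>1 p \<alpha> n).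
               FN n \<theta> d \<le> \<beta> + \<epsilon>)) \<longlonglongrightarrow> 1)
     \<and>
     (\<forall>\<delta> \<beta>.
        (\<forall>n\<ge>1. \<delta> n \<in> decision_rules M n) \<longrightarrow>
        (\<lambda>n. \<P>(((\<theta>, X), d) in decision_law M f0 f1 \<pi>1 n (\<delta> n). FDP n \<theta> d \<le> \<alpha>)) \<longlonglongrightarrow> 1 \<longrightarrow>
        (\<forall>n\<ge>1. EFN M f0 f1 \<pi>1 n (\<delta> n) \<le> \<beta>) \<longrightarrow>
        \<beta> \<ge> mEFN_star M f0 f1 \<pi>1 m \<alpha>)"
proof -
  interpret two_group_np M f0 f1 \<pi>0 \<pi>1 p \<alpha>
    using assms by unfold_locales
  \<comment> \<open>Both parts of the claim now refer to the missed mass of the test of size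
    \<open>ustar\<close>, which is free of \<open>m\<close>.\<close>
  show ?thesis
    unfolding mEFN_star_eq[OF \<open>m \<ge> 1\<close>] case_prod_unfold prod.collapse
  proof (intro conjI allI impI)
    fix \<delta> \<beta>
    assume "\<forall>n\<ge>1. \<delta> n \<in> decision_rules M n" "\<forall>n\<ge>1. EFN M f0 f1 \<pi>1 n (\<delta> n) \<le> \<beta>"
      and "(\<lambda>n. \<P>(z in D n (\<delta> n). FDP n (fst (fst z)) (snd z) \<le> \<alpha>)) \<longlonglongrightarrow> 1"
    then show "np.miss np.ustar \<le> \<beta>" by (intro converse) auto
  qed (simp_all only: NP_FDP NP_FN)
qed

end
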